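(* Let $k\geq 1$, let $\mathcal{G}\rightrightarrows M$ be a source-simply-connected Lie groupoid with Lie algebroid $A\to M$, let $\omega\in\Omega^{k+1}(\mathcal{G})$ be a closed, multiplicative differential form, and let $\mu:A\to\wedge^kT^*M$ be its corresponding (closed) IM $(k+1)$-form. Then $\omega$ is nondegenerate if and only if $\mu$ satisfies both of the following conditions: \begin{itemize} \item[(1)] $\ker\mu=\{0\}$ (i.e. $\mu$ is fibrewise injective); \item[(2)] $(\mathrm{Im}(\mu))^\circ:=\{X\in TM \mid i_X\mu(u)=0\ \ \forall u\in A\}=\{0\}$, where the condition is understood fibrewise: for $X\in T_xM$, $u$ ranges over $A|_x$. \end{itemize}
   Context: Everything is smooth. For a Lie groupoid $\mathcal{G}\rightrightarrows M$, write $\mathsf{s},\mathsf{t}:\mathcal{G}\to M$ for the source and target maps, $\mathcal{G}\,{}_{\mathsf{s}}\!\times_{\mathsf{t}}\mathcal{G}=\{(g,h)\in\mathcal{G}\times\mathcal{G} \mid \mathsf{s}(g)=\mathsf{t}(h)\}$ for the space of composable arrows, $m:\mathcal{G}\,{}_{\mathsf{s}}\!\times_{\mathsf{t}}\mathcal{G}\to\mathcal{G}$ for the multiplication, and $\epsilon:M\hookrightarrow\mathcal{G}$ for the unit map, by means of which $M$ is viewed as a submanifold of $\mathcal{G}$. Source-simply-connected means that the fibres of $\mathsf{s}$ are connected and simply connected. The Lie algebroid of $\mathcal{G}$ is $A=\ker(d\mathsf{s})|_M$, with anchor $\rho=d\mathsf{t}|_A:A\to TM$ and bracket on $\Gamma(A)$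 induced by the Lie bracket of right-invariant vector fields on $\mathcal{G}$. One has $T\mathcal{G}|_M=TM\oplus A$. A form $\omega\in\Omega^{r}(\mathcal{G})$ is multiplicative if $m^*\omega=\mathrm{pr}_1^*\omega+\mathrm{pr}_2^*\omega$, where $\mathrm{pr}_i:\mathcal{G}\,{}_{\mathsf{s}}\!\times_{\mathsf{t}}\mathcal{G}\to\mathcal{G}$ is the projection on the $i$-th factor. A form $\omega$ of degree $k+1$ is nondegenerate if $i_X\omega=0$ implies $X=0$ for every tangent vector $X$, i.e. the bundle map $T\mathcal{G}\to\wedge^kT^*\mathcal{G}$, $X\mapsto i_X\omega$, is injective. A (closed) IM $(k+1)$-form on a Lie algebroid $A\to M$ with anchor $\rho$ is a vector-bundle map $\mu:A\to\wedge^kT^*M$ covering the identity of $M$ such that, for all $u,v\in\Gamma(A)$, $$i_{\rho(u)}\mu(v)=-i_{\rho(v)}\mu(u),\qquad \mu([u,v])=\mathcal{L}_{\rho(u)}\mu(v)-i_{\rho(v)}d(\mu(u)).$$ It is a known result that for source-simply-connected $\mathcal{G}$ closed multiplicative $(k+1)$-forms $\omega$ on $\mathcal{G}$ are in one-to-one correspondence with closed IM $(k+1)$-forms $\mu$ on $A$; the IM form $\mu$ corresponding to $\omega$ is given by $$i_{X_k}\cdots i_{X_1}\mu_x(u)=\omega_x(u,X_1,\ldots,X_k),\qquad x\in M,\ u\in A|_x,\ X_1,\dots,X_k\in T_xM .$$ *)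

theory Defs
  imports "HOL-Analysis.Analysis"
begin

section \<open>Smooth manifolds\<close>

text \<open>Iterated directional derivatives; the set is meant to be open. On finite-dimensional
  spaces this is the usual \<open>C\<^sup>n\<close> condition.\<close>

fun Ck_on :: "nat \<Rightarrow> ('a::real_normed_vector \<Rightarrow> 'b::real_normed_vector) \<Rightarrow> 'a set \<Rightarrow> bool" where
  "Ck_on 0 f S \<longleftrightarrow> continuous_on S f"
| "Ck_on (Suc n) f S \<longleftrightarrow> (\<forall>x\<in>S. f differentiable (at x)) \<and>
     (\<forall>v. Ck_on n (\<lambda>x. frechet_derivative f (at x) v) S)"

definition smooth_on :: "('a::real_normed_vector \<Rightarrow> 'b::real_normed_vector) \<Rightarrow> 'a set \<Rightarrow> bool" where
  "smooth_on f S \<longleftrightarrow> (\<forall>n. Ck_on n f S)"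

text \<open>A manifold is given by the points of a type, with its topology, and an atlas. Its model
  space is a type satisfying the axioms of class \<open>euclidean_space\<close> except that the orthonormal
  basis may be empty, so that manifolds of dimension 0 are included.\<close>

type_synonym ('a, 'e) atlas = "('a set \<times> ('a \<Rightarrow> 'e)) set"

definition chart_inv :: "'a set \<times> ('a \<Rightarrow> 'e) \<Rightarrow> 'e \<Rightarrow> 'a" where
  "chart_inv c = inv_into (fst c) (snd c)"

definition smooth_manifold ::
    "('a::{t2_space, second_countable_topology}, 'e::real_inner) atlas \<Rightarrow> bool" where
  "smooth_manifold A \<longleftrightarrow>
     (\<exists>B::'e set. finite B \<and> (\<forall>b\<in>B. \<forall>b'\<in>B. b \<bullet> b' = (if b = b' then 1 else 0)) \<and> span B = UNIV) \<and>
     (\<Union>c\<in>A. fst c) = UNIV \<and>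
     (\<forall>c\<in>A. open (fst c) \<and> open (snd c ` fst c) \<and>
        homeomorphism (fst c) (snd c ` fst c) (snd c) (chart_inv c)) \<and>
     (\<forall>c\<in>A. \<forall>d\<in>A. smooth_on (snd d \<circ> chart_inv c) (snd c ` (fst c \<inter> fst d)))"

definition prod_atlas :: "('a, 'e) atlas \<Rightarrow> ('b, 'f) atlas \<Rightarrow> ('a \<times> 'b, 'e \<times> 'f) atlas" where
  "prod_atlas A B = (\<lambda>(c, d). (fst c \<times> fst d, map_prod (snd c) (snd d))) ` (A \<times> B)"

text \<open>The tangent space at \<open>p\<close> is the model space, a vector being represented by its coordinates
  in the chart chosen here.\<close>

definition chart_at :: "('a, 'e) atlas \<Rightarrow> 'a \<Rightarrow> 'a set \<times> ('a \<Rightarrow> 'e)" where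
  "chart_at A p = (SOME c. c \<in> A \<and> p \<in> fst c)"

text \<open>\<open>tangent_coord A c p v\<close> are the coordinates in the chart \<open>c\<close> of the tangent vector \<open>v\<close>
  at \<open>p\<close>; \<open>coord_tangent A c p w\<close> is the tangent vector at \<open>p\<close> with coordinates \<open>w\<close> in \<open>c\<close>.\<close>

definition tangent_coord ::
    "('a, 'e::real_normed_vector) atlas \<Rightarrow> 'a set \<times> ('a \<Rightarrow> 'e) \<Rightarrow> 'a \<Rightarrow> 'e \<Rightarrow> 'e" where
  "tangent_coord A c p v =
     frechet_derivative (snd c \<circ> chart_inv (chart_at A p)) (at (snd (chart_at A p) p)) v"

definition coord_tangent ::
    "('a, 'e::real_normed_vector) atlas \<Rightarrow> 'a set \<times> ('a \<Rightarrow> 'e) \<Rightarrow> 'a \<Rightarrow> 'e \<Rightarrow> 'e" where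
  "coord_tangent A c p w =
     frechet_derivative (snd (chart_at A p) \<circ> chart_inv c) (at (snd c p)) w"

definition mdiff ::
    "('a, 'e::real_normed_vector) atlas \<Rightarrow> ('b, 'f::real_normed_vector) atlas \<Rightarrow>
     ('a \<Rightarrow> 'b) \<Rightarrow> 'a \<Rightarrow> 'e \<Rightarrow> 'f" where
  "mdiff A B f p v =
     frechet_derivative (snd (chart_at B (f p)) \<circ> f \<circ> chart_inv (chart_at A p))
       (at (snd (chart_at A p) p)) v"

definition smooth_map_on ::
    "('a::topological_space, 'e::real_normed_vector) atlas \<Rightarrow>
     ('b::topological_space, 'f::real_normed_vector) atlas \<Rightarrow> 'a set \<Rightarrow> ('a \<Rightarrow> 'b) \<Rightarrow> bool" where
  "smooth_map_on A B W f \<longleftrightarrow> open W \<and> continuous_on W f \<and>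
     (\<forall>c\<in>A. \<forall>d\<in>B. smooth_on (snd d \<circ> f \<circ> chart_inv c) (snd c ` (fst c \<inter> W \<inter> f -` fst d)))"

text \<open>Maps defined on an embedded submanifold \<open>S\<close> are smooth iff they extend locally to smooth maps
  on the ambient manifold. On vectors tangent to \<open>S\<close> (and only there) the value of
  \<open>mdiff_within\<close> does not depend on the chosen extension, and is the differential of \<open>f\<close>.\<close>

definition local_extension ::
    "('a::topological_space, 'e::real_normed_vector) atlas \<Rightarrow>
     ('b::topological_space, 'f::real_normed_vector) atlas \<Rightarrow>
     'a set \<Rightarrow> ('a \<Rightarrow> 'b) \<Rightarrow> 'a \<Rightarrow> ('a \<Rightarrow> 'b) \<Rightarrow> bool" where
  "local_extension A B S f p f' \<longleftrightarrow>
     (\<exists>W. p \<in> W \<and> smooth_map_on A B W f' \<and> (\<forall>q\<in>S \<inter> W. f' q = f q))"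

definition smooth_map_within ::
    "('a::topological_space, 'e::real_normed_vector) atlas \<Rightarrow>
     ('b::topological_space, 'f::real_normed_vector) atlas \<Rightarrow> 'a set \<Rightarrow> ('a \<Rightarrow> 'b) \<Rightarrow> bool" where
  "smooth_map_within A B S f \<longleftrightarrow> (\<forall>p\<in>S. \<exists>f'. local_extension A B S f p f')"

definition mdiff_within ::
    "('a::topological_space, 'e::real_normed_vector) atlas \<Rightarrow>
     ('b::topological_space, 'f::real_normed_vector) atlas \<Rightarrow>
     'a set \<Rightarrow> ('a \<Rightarrow> 'b) \<Rightarrow> 'a \<Rightarrow> 'e \<Rightarrow> 'f" where
  "mdiff_within A B S f p = mdiff A B (SOME f'. local_extension A B S f p f') p"

section \<open>Vector fields and differential forms\<close>

text \<open>\<open>u\<close> is a section of the pullback of the tangent bundle of the target along \<open>f\<close>.\<close>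

definition smooth_field_along ::
    "('a, 'e::real_normed_vector) atlas \<Rightarrow> ('b, 'f::real_normed_vector) atlas \<Rightarrow>
     ('a \<Rightarrow> 'b) \<Rightarrow> ('a \<Rightarrow> 'f) \<Rightarrow> bool" where
  "smooth_field_along A B f u \<longleftrightarrow>
     (\<forall>c\<in>A. \<forall>d\<in>B. smooth_on (\<lambda>y. tangent_coord B d (f (chart_inv c y)) (u (chart_inv c y)))
        (snd c ` (fst c \<inter> f -` fst d)))"

definition local_field ::
    "('a, 'e::real_normed_vector) atlas \<Rightarrow> 'a set \<times> ('a \<Rightarrow> 'e) \<Rightarrow> ('a \<Rightarrow> 'e) \<Rightarrow> 'e \<Rightarrow> 'e" where
  "local_field A c X y = tangent_coord A c (chart_inv c y) (X (chart_inv c y))"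

text \<open>In a chart, \<open>[X,Y] = DY(X) - DX(Y)\<close>. In the chart chosen at \<open>p\<close>, the vectors \<open>X p\<close> and \<open>Y p\<close>
  coincide with their coordinates.\<close>

definition lie_bracket ::
    "('a, 'e::real_normed_vector) atlas \<Rightarrow> ('a \<Rightarrow> 'e) \<Rightarrow> ('a \<Rightarrow> 'e) \<Rightarrow> 'a \<Rightarrow> 'e" where
  "lie_bracket A X Y p =
     (let c = chart_at A p in
        frechet_derivative (local_field A c Y) (at (snd c p)) (X p) -
        frechet_derivative (local_field A c X) (at (snd c p)) (Y p))"

text \<open>An \<open>r\<close>-form takes at each point a list of \<open>r\<close> tangent vectors; its values on lists of
  other lengths are irrelevant.\<close>

type_synonym ('a, 'e) form = "'a \<Rightarrow> 'e list \<Rightarrow> real"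

definition alternating_form :: "nat \<Rightarrow> ('e::real_vector list \<Rightarrow> real) \<Rightarrow> bool" where
  "alternating_form r f \<longleftrightarrow>
     (\<forall>vs. length vs = r \<longrightarrow>
        (\<forall>i<r. linear (\<lambda>v. f (vs[i := v]))) \<and>
        (\<forall>i<r. \<forall>j<r. i \<noteq> j \<and> vs ! i = vs ! j \<longrightarrow> f vs = 0))"

definition local_form ::
    "('a, 'e::real_normed_vector) atlas \<Rightarrow> 'a set \<times> ('a \<Rightarrow> 'e) \<Rightarrow> ('a, 'e) form \<Rightarrow> 'e \<Rightarrow> 'e list \<Rightarrow> real"
  where
  "local_form A c \<alpha> y ws = \<alpha> (chart_inv c y) (map (coord_tangent A c (chart_inv c y)) ws)"

definition smooth_form :: "('a, 'e::real_normed_vector) atlas \<Rightarrow> nat \<Rightarrow> ('a, 'e) form \<Rightarrow> bool" where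
  "smooth_form A r \<alpha> \<longleftrightarrow>
     (\<forall>p. alternating_form r (\<alpha> p)) \<and>
     (\<forall>c\<in>A. \<forall>ws. length ws = r \<longrightarrow> smooth_on (\<lambda>y. local_form A c \<alpha> y ws) (snd c ` fst c))"

text \<open>In a chart,
  \<open>d\<alpha>(v\<^sub>0,\<dots>,v\<^sub>r) = \<Sum>\<^sub>i (-1)\<^sup>i D(\<alpha>(v\<^sub>0,\<dots>,v\<^sub>i omitted,\<dots>,v\<^sub>r))(v\<^sub>i)\<close> for constant \<open>v\<^sub>0,\<dots>,v\<^sub>r\<close>.\<close>

definition ext_deriv :: "('a, 'e::real_normed_vector) atlas \<Rightarrow> ('a, 'e) form \<Rightarrow> ('a, 'e) form" where
  "ext_deriv A \<alpha> p vs =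
     (let c = chart_at A p in
        \<Sum>i<length vs. (- 1) ^ i *
          frechet_derivative (\<lambda>y. local_form A c \<alpha> y (take i vs @ drop (Suc i) vs))
            (at (snd c p)) (vs ! i))"

definition closed_form :: "('a, 'e::real_normed_vector) atlas \<Rightarrow> nat \<Rightarrow> ('a, 'e) form \<Rightarrow> bool" where
  "closed_form A r \<alpha> \<longleftrightarrow> (\<forall>p vs. length vs = Suc r \<longrightarrow> ext_deriv A \<alpha> p vs = 0)"

definition contract :: "('a \<Rightarrow> 'e) \<Rightarrow> ('a, 'e) form \<Rightarrow> ('a, 'e) form" where
  "contract X \<alpha> p vs = \<alpha> p (X p # vs)"

text \<open>Cartan's formula.\<close>

definition lie_deriv ::
    "('a, 'e::real_normed_vector) atlas \<Rightarrow> ('a \<Rightarrow> 'e) \<Rightarrow> ('a, 'e) form \<Rightarrow> ('a, 'e) form" where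
  "lie_deriv A X \<alpha> p vs = ext_deriv A (contract X \<alpha>) p vs + contract X (ext_deriv A \<alpha>) p vs"

definition nondegenerate :: "nat \<Rightarrow> ('a, 'e::real_vector) form \<Rightarrow> bool" where
  "nondegenerate r \<omega> \<longleftrightarrow>
     (\<forall>p X. (\<forall>vs. Suc (length vs) = r \<longrightarrow> \<omega> p (X # vs) = 0) \<longrightarrow> X = 0)"

section \<open>Lie groupoids\<close>

record ('g, 'a, 'm, 'b) groupoid_data =
  arrows :: "('g, 'a) atlas"
  objects :: "('m, 'b) atlas"
  src :: "'g \<Rightarrow> 'm"
  tgt :: "'g \<Rightarrow> 'm"
  unit_at :: "'m \<Rightarrow> 'g"
  inverse_of :: "'g \<Rightarrow> 'g"
  mult :: "'g \<Rightarrow> 'g \<Rightarrow> 'g"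

definition composable :: "('g, 'a, 'm, 'b) groupoid_data \<Rightarrow> ('g \<times> 'g) set" where
  "composable G = {(g, h). src G g = tgt G h}"

definition lie_groupoid ::
    "('g::{t2_space, second_countable_topology}, 'a::real_inner,
      'm::{t2_space, second_countable_topology}, 'b::real_inner) groupoid_data \<Rightarrow> bool" where
  "lie_groupoid G \<longleftrightarrow>
     smooth_manifold (arrows G) \<and> smooth_manifold (objects G) \<and>
     (\<forall>x. src G (unit_at G x) = x \<and> tgt G (unit_at G x) = x) \<and>
     (\<forall>g. src G (inverse_of G g) = tgt G g \<and> tgt G (inverse_of G g) = src G g) \<and>
     (\<forall>g h. src G g = tgt G h \<longrightarrow> src G (mult G g h) = src G h \<and> tgt G (mult G g h) = tgt G g) \<and>
     (\<forall>g h l. src G g = tgt G h \<and> src G h = tgt G l \<longrightarrow>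
        mult G (mult G g h) l = mult G g (mult G h l)) \<and>
     (\<forall>g. mult G (unit_at G (tgt G g)) g = g \<and> mult G g (unit_at G (src G g)) = g) \<and>
     (\<forall>g. mult G g (inverse_of G g) = unit_at G (tgt G g) \<and>
          mult G (inverse_of G g) g = unit_at G (src G g)) \<and>
     smooth_map_on (arrows G) (objects G) UNIV (src G) \<and>
     smooth_map_on (arrows G) (objects G) UNIV (tgt G) \<and>
     (\<forall>g. surj (mdiff (arrows G) (objects G) (src G) g)) \<and>
     (\<forall>g. surj (mdiff (arrows G) (objects G) (tgt G) g)) \<and>
     smooth_map_on (objects G) (arrows G) UNIV (unit_at G) \<and>
     smooth_map_on (arrows G) (arrows G) UNIV (inverse_of G) \<and>
     smooth_map_within (prod_atlas (arrows G) (arrows G)) (arrows G) (composable G)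
       (\<lambda>(g, h). mult G g h)"

definition source_simply_connected ::
    "('g::topological_space, 'a, 'm, 'b) groupoid_data \<Rightarrow> bool" where
  "source_simply_connected G \<longleftrightarrow>
     (\<forall>x. connected {g. src G g = x} \<and> simply_connected {g. src G g = x})"

text \<open>The tangent space of the fibre product, inside that of the product of \<open>G\<close> with itself.\<close>

definition composable_tangent ::
    "('g, 'a::real_normed_vector, 'm, 'b::real_normed_vector) groupoid_data \<Rightarrow>
     'g \<times> 'g \<Rightarrow> ('a \<times> 'a) set" where
  "composable_tangent G p =
     {Z. mdiff (arrows G) (objects G) (src G) (fst p)
           (mdiff (prod_atlas (arrows G) (arrows G)) (arrows G) fst p Z) =
         mdiff (arrows G) (objects G) (tgt G) (snd p)
           (mdiff (prod_atlas (arrows G) (arrows G)) (arrows G) snd p Z)}"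

definition multiplicative ::
    "('g::topological_space, 'a::real_normed_vector, 'm, 'b::real_normed_vector) groupoid_data \<Rightarrow>
     nat \<Rightarrow> ('g, 'a) form \<Rightarrow> bool" where
  "multiplicative G r \<omega> \<longleftrightarrow>
     (let P = prod_atlas (arrows G) (arrows G); m = (\<lambda>(g, h). mult G g h) in
      \<forall>p\<in>composable G. \<forall>Zs. length Zs = r \<and> set Zs \<subseteq> composable_tangent G p \<longrightarrow>
        \<omega> (m p) (map (mdiff_within P (arrows G) (composable G) m p) Zs) =
        \<omega> (fst p) (map (mdiff P (arrows G) fst p) Zs) +
        \<omega> (snd p) (map (mdiff P (arrows G) snd p) Zs))"

section \<open>The Lie algebroid and IM forms\<close>

definition algebroid_fibre ::
    "('g, 'a::real_normed_vector, 'm, 'b::real_normed_vector) groupoid_data \<Rightarrow> 'm \<Rightarrow> 'a set" where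
  "algebroid_fibre G x = {u. mdiff (arrows G) (objects G) (src G) (unit_at G x) u = 0}"

definition anchor ::
    "('g, 'a::real_normed_vector, 'm, 'b::real_normed_vector) groupoid_data \<Rightarrow> 'm \<Rightarrow> 'a \<Rightarrow> 'b" where
  "anchor G x u = mdiff (arrows G) (objects G) (tgt G) (unit_at G x) u"

definition algebroid_section ::
    "('g, 'a::real_normed_vector, 'm, 'b::real_normed_vector) groupoid_data \<Rightarrow> ('m \<Rightarrow> 'a) \<Rightarrow> bool" where
  "algebroid_section G u \<longleftrightarrow>
     (\<forall>x. u x \<in> algebroid_fibre G x) \<and>
     smooth_field_along (objects G) (arrows G) (unit_at G) u"

text \<open>The right-invariant vector field of a section, by means of the right translations
  \<open>h \<mapsto> hg\<close> of the source fibre over \<open>tgt G g\<close>.\<close>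

definition right_invariant ::
    "('g::topological_space, 'a::real_normed_vector, 'm, 'b::real_normed_vector) groupoid_data \<Rightarrow>
     ('m \<Rightarrow> 'a) \<Rightarrow> 'g \<Rightarrow> 'a" where
  "right_invariant G u g =
     mdiff_within (arrows G) (arrows G) {h. src G h = tgt G g} (\<lambda>h. mult G h g)
       (unit_at G (tgt G g)) (u (tgt G g))"

definition algebroid_bracket ::
    "('g::topological_space, 'a::real_normed_vector, 'm, 'b::real_normed_vector) groupoid_data \<Rightarrow>
     ('m \<Rightarrow> 'a) \<Rightarrow> ('m \<Rightarrow> 'a) \<Rightarrow> 'm \<Rightarrow> 'a" where
  "algebroid_bracket G u v x =
     lie_bracket (arrows G) (right_invariant G u) (right_invariant G v) (unit_at G x)"

text \<open>\<open>\<mu> x u\<close> is a \<open>k\<close>-form on the tangent space at \<open>x\<close> for \<open>u\<close> in the fibre of the algebroid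
  over \<open>x\<close>; other values of \<open>u\<close> are irrelevant. A fibrewise linear map of bundles is smooth iff it
  maps smooth sections to smooth sections.\<close>

definition closed_IM_form ::
    "('g::topological_space, 'a::real_normed_vector, 'm, 'b::real_normed_vector) groupoid_data \<Rightarrow>
     nat \<Rightarrow> ('m \<Rightarrow> 'a \<Rightarrow> 'b list \<Rightarrow> real) \<Rightarrow> bool" where
  "closed_IM_form G k \<mu> \<longleftrightarrow>
     (\<forall>x. \<forall>u\<in>algebroid_fibre G x. alternating_form k (\<mu> x u)) \<and>
     (\<forall>x. \<forall>u\<in>algebroid_fibre G x. \<forall>v\<in>algebroid_fibre G x. \<forall>a b Xs. length Xs = k \<longrightarrow>
        \<mu> x (a *\<^sub>R u + b *\<^sub>R v) Xs = a * \<mu> x u Xs + b * \<mu> x v Xs) \<and>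
     (\<forall>u. algebroid_section G u \<longrightarrow> smooth_form (objects G) k (\<lambda>x. \<mu> x (u x))) \<and>
     (\<forall>u v. algebroid_section G u \<and> algebroid_section G v \<longrightarrow>
        (let \<rho>u = (\<lambda>x. anchor G x (u x)); \<rho>v = (\<lambda>x. anchor G x (v x));
             \<mu>u = (\<lambda>x. \<mu> x (u x)); \<mu>v = (\<lambda>x. \<mu> x (v x)) in
         (\<forall>x Xs. Suc (length Xs) = k \<longrightarrow> contract \<rho>u \<mu>v x Xs = - contract \<rho>v \<mu>u x Xs) \<and>
         (\<forall>x Xs. length Xs = k \<longrightarrow>
            \<mu> x (algebroid_bracket G u v x) Xs =
            lie_deriv (objects G) \<rho>u \<mu>v x Xs - contract \<rho>v (ext_deriv (objects G) \<mu>u) x Xs)))"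

definition corresponds ::
    "('g, 'a::real_normed_vector, 'm, 'b::real_normed_vector) groupoid_data \<Rightarrow> nat \<Rightarrow>
     ('g, 'a) form \<Rightarrow> ('m \<Rightarrow> 'a \<Rightarrow> 'b list \<Rightarrow> real) \<Rightarrow> bool" where
  "corresponds G k \<omega> \<mu> \<longleftrightarrow>
     (\<forall>x. \<forall>u\<in>algebroid_fibre G x. \<forall>Xs. length Xs = k \<longrightarrow>
        \<mu> x u Xs =
        \<omega> (unit_at G x) (u # map (mdiff (objects G) (arrows G) (unit_at G) x) Xs))"

definition IM_kernel ::
    "('g, 'a::real_normed_vector, 'm, 'b::real_normed_vector) groupoid_data \<Rightarrow> nat \<Rightarrow>
     ('m \<Rightarrow> 'a \<Rightarrow> 'b list \<Rightarrow> real) \<Rightarrow> 'm \<Rightarrow> 'a set" where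
  "IM_kernel G k \<mu> x = {u \<in> algebroid_fibre G x. \<forall>Xs. length Xs = k \<longrightarrow> \<mu> x u Xs = 0}"

definition IM_image_annihilator ::
    "('g, 'a::real_normed_vector, 'm, 'b::real_normed_vector) groupoid_data \<Rightarrow> nat \<Rightarrow>
     ('m \<Rightarrow> 'a \<Rightarrow> 'b list \<Rightarrow> real) \<Rightarrow> 'm \<Rightarrow> 'b set" where
  "IM_image_annihilator G k \<mu> x =
     {X. \<forall>u\<in>algebroid_fibre G x. \<forall>Xs. Suc (length Xs) = k \<longrightarrow> \<mu> x u (X # Xs) = 0}"

end

theory Submission
  imports Defs
begin

text \<open>
  Multiplicativity is a statement about the multiplication of the tangent groupoid of \<open>G\<close>. Applied
  to products of vectors with unit vectors and zero vectors it gives, at every arrow \<open>g\<close>, the formula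
  \<open>\<omega>\<^sub>g(u\<cdot>0\<^sub>g, Y\<^sub>1, \<dots>, Y\<^sub>k) = \<mu>(u)(dt Y\<^sub>1, \<dots>, dt Y\<^sub>k)\<close> for \<open>u\<close> in the algebroid fibre over \<open>t(g)\<close>, and
  also that the units are isotropic and that the inversion changes the sign of \<open>\<omega>\<close>.

  At a unit the formula reads \<open>\<omega>(u, Y\<^sub>1, \<dots>, Y\<^sub>k) = \<mu>(u)(dt Y\<^sub>1, \<dots>, dt Y\<^sub>k)\<close>. With the splitting of the
  tangent space at a unit and isotropy, it turns elements of the kernel of \<open>\<mu>\<close> and of the annihilator of
  its image into elements of the kernel of \<open>\<omega>\<close>. Conversely, if \<open>X\<close> at \<open>g\<close> lies in the kernel of \<open>\<omega>\<close>,
  then by the formula \<open>dt X\<close> annihilates the image of \<open>\<mu>\<close>, so \<open>dt X = 0\<close>; by inversion \<open>ds X = 0\<close>. So \<open>X\<close> is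
  the right translate of some \<open>u\<close> in the algebroid, which lies in the kernel of \<open>\<mu>\<close>.

  All products of tangent vectors are computed by the chain rule along maps into the space of
  composable arrows; only for the last step is a curve in a source fibre needed, and thus a form
  of the implicit function theorem.
\<close>

section \<open>Curves in level sets\<close>

lemma isCont_tendsto_nhds: "isCont f a \<Longrightarrow> (f \<longlongrightarrow> f a) (nhds a)"
  by (simp add: isCont_def tendsto_at_iff_tendsto_nhds)

text \<open>A model space is an inner product space with a finite orthonormal spanning set.
  Coordinates reduce convergence to finitely many real sequences, which yields the completeness that
  the fixed point argument below needs.\<close>

lemma complete_finite_orthonormal:
  fixes B :: "'e::real_inner set"
  assumes "finite B" and B: "\<forall>b\<in>B. \<forall>b'\<in>B. b \<bullet> b' = (if b = b' then 1 else 0)" and "span B = UNIV"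
  shows orthonormal_expansion: "\<And>x. (\<Sum>b\<in>B. (x \<bullet> b) *\<^sub>R b) = (x::'e)" and "complete (UNIV :: 'e set)"
proof -
  show expand: "(\<Sum>b\<in>B. (x \<bullet> b) *\<^sub>R b) = x" for x
  proof -
    have "x \<in> span B" using assms(3) by simp
    then show ?thesis
    proof (induction rule: span_induct_alt)
      case base
      then show ?case by simp
    next
      case (step c x y)
      have "(\<Sum>b\<in>B. (x \<bullet> b) *\<^sub>R b) = (\<Sum>b\<in>B. if b = x then b else 0)"
        by (rule sum.cong) (use B step in auto)
      also have "\<dots> = x" using \<open>finite B\<close> step by simp
      finally have "c *\<^sub>R (\<Sum>b\<in>B. (x \<bullet> b) *\<^sub>R b) = c *\<^sub>R x" by simp
      with step show ?case
        by (simp add: inner_add_left scaleR_add_left sum.distrib scaleR_sum_right)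
    qed
  qed
  show "complete (UNIV :: 'e set)"
    unfolding complete_def
  proof safe
    fix f :: "nat \<Rightarrow> 'e"
    assume f: "Cauchy f"
    have "Cauchy (\<lambda>n. f n \<bullet> b)" for b
      using bounded_linear.Cauchy[OF bounded_linear_inner_left f] .
    then have "\<And>b. (\<lambda>n. f n \<bullet> b) \<longlonglongrightarrow> lim (\<lambda>n. f n \<bullet> b)"
      by (simp add: Cauchy_convergent_iff convergent_LIMSEQ_iff)
    then have "(\<lambda>n. \<Sum>b\<in>B. (f n \<bullet> b) *\<^sub>R b) \<longlonglongrightarrow> (\<Sum>b\<in>B. lim (\<lambda>n. f n \<bullet> b) *\<^sub>R b)"
      by (intro tendsto_intros)
    then show "\<exists>l\<in>UNIV. f \<longlonglongrightarrow> l" by (auto simp: expand)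
  qed
qed

text \<open>Strict differentiability: near \<open>p\<close> the derivative is within
  \<open>e\<close> of its value at \<open>p\<close> in operator norm, and the mean value inequality
  on a ball then controls the linearization error between any two points of the ball.\<close>

lemma Ck_on_strict_derivative:
  fixes F :: "'a::real_inner \<Rightarrow> 'b::real_normed_vector"
  assumes "finite B" "\<forall>b\<in>B. \<forall>b'\<in>B. b \<bullet> b' = (if b = b' then 1 else 0)" "span B = (UNIV :: 'a set)"
    and S: "open S" "p \<in> S" and F: "Ck_on 1 F S" and "e > 0"
  obtains d where "d > 0" "ball p d \<subseteq> S"
    "\<And>x y. x \<in> ball p d \<Longrightarrow> y \<in> ball p d \<Longrightarrow>
       norm (F y - F x - frechet_derivative F (at p) (y - x)) \<le> e * norm (y - x)"
proof -
  let ?D = "\<lambda>x. frechet_derivative F (at x)"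
  have der: "(F has_derivative ?D x) (at x)" if "x \<in> S" for x
    using F that by (simp add: frechet_derivative_works)
  have lin: "bounded_linear (?D x)" if "x \<in> S" for x
    using der[OF that] by (rule has_derivative_bounded_linear)
  \<comment> \<open>\<open>Ck_on\<close> makes the derivative continuous only on each fixed vector.
    Summing over the finite basis turns this into a bound for the operator norm.\<close>
  have cont: "continuous_on S (\<lambda>x. ?D x b)" for b
    using F by simp
  have "isCont (\<lambda>x. \<Sum>b\<in>B. norm (?D x b - ?D p b)) p"
    using cont S by (intro continuous_intros) (simp add: continuous_on_eq_continuous_at)
  then have "((\<lambda>x. \<Sum>b\<in>B. norm (?D x b - ?D p b)) \<longlongrightarrow> 0) (nhds p)"
    by (auto dest: isCont_tendsto_nhds)
  then have "\<forall>\<^sub>F x in nhds p. (\<Sum>b\<in>B. norm (?D x b - ?D p b)) < e"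
    using \<open>e > 0\<close> by (rule order_tendstoD)
  moreover have "\<forall>\<^sub>F x in nhds p. x \<in> S"
    using S by (simp add: eventually_nhds_in_open)
  ultimately have "\<forall>\<^sub>F x in nhds p. (\<Sum>b\<in>B. norm (?D x b - ?D p b)) < e \<and> x \<in> S"
    by (rule eventually_conj)
  then obtain d where d: "d > 0"
      "\<And>x. dist x p < d \<Longrightarrow> (\<Sum>b\<in>B. norm (?D x b - ?D p b)) < e \<and> x \<in> S"
    unfolding eventually_nhds_metric by blast
  have on: "onorm (\<lambda>h. ?D x h - ?D p h) \<le> e" if x: "dist x p < d" for x
  proof (rule onorm_bound)
    show "0 \<le> e" using \<open>e > 0\<close> by simp
    fix h
    have L: "linear (\<lambda>h. ?D x h - ?D p h)"
      using lin[of x] lin[of p] d(2)[OF x] S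
      by (intro bounded_linear.linear bounded_linear_sub) auto
    have "?D x h - ?D p h = (\<lambda>h. ?D x h - ?D p h) (\<Sum>b\<in>B. (h \<bullet> b) *\<^sub>R b)"
      using orthonormal_expansion[OF assms(1-3), of h] by simp
    also have "\<dots> = (\<Sum>b\<in>B. (h \<bullet> b) *\<^sub>R (?D x b - ?D p b))"
      using linear_sum[OF L, of "\<lambda>b. (h \<bullet> b) *\<^sub>R b" B] linear_scale[OF L] by simp
    also have "norm \<dots> \<le> (\<Sum>b\<in>B. norm h * norm (?D x b - ?D p b))"
    proof (rule sum_norm_le)
      fix b assume "b \<in> B"
      then have "norm b = 1" using assms(2) by (simp add: norm_eq_1)
      then have "\<bar>h \<bullet> b\<bar> \<le> norm h" using Cauchy_Schwarz_ineq2[of h b] by simp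
      then show "norm ((h \<bullet> b) *\<^sub>R (?D x b - ?D p b)) \<le> norm h * norm (?D x b - ?D p b)"
        by (simp add: mult_right_mono)
    qed
    also have "\<dots> = norm h * (\<Sum>b\<in>B. norm (?D x b - ?D p b))"
      by (simp add: sum_distrib_left)
    also have "\<dots> \<le> norm h * e"
      using d(2)[OF x] by (intro mult_left_mono) auto
    finally show "norm (?D x h - ?D p h) \<le> e * norm h" by (simp add: mult.commute)
  qed
  show thesis
  proof
    show "d > 0" by fact
    show sub: "ball p d \<subseteq> S" using d(2) by (auto simp: dist_commute)
    fix x y assume xy: "x \<in> ball p d" "y \<in> ball p d"
    have "norm (F y - F x - ?D p (y - x)) \<le> norm (y - x) * e"
    proof (rule differentiable_bound_linearization[where S = "ball p d"])
      fix t :: real assume "t \<in> {0..1}"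
      moreover have "x + t *\<^sub>R (y - x) = (1 - t) *\<^sub>R x + t *\<^sub>R y"
        by (simp add: algebra_simps)
      ultimately show "x + t *\<^sub>R (y - x) \<in> ball p d"
        using convexD_alt[OF convex_ball xy, of t] by (metis atLeastAtMost_iff)
    next
      fix z assume "z \<in> ball p d"
      then show "(F has_derivative ?D z) (at z within ball p d)"
        using sub by (blast intro: has_derivative_at_withinI[OF der])
    next
      show "p \<in> ball p d" using \<open>d > 0\<close> by simp
    next
      fix z assume "z \<in> ball p d"
      then show "onorm (?D z - ?D p) \<le> e" using on[of z] by (simp add: dist_commute fun_diff_def)
    qed
    then show "norm (F y - F x - ?D p (y - x)) \<le> e * norm (y - x)" by (simp add: mult.commute)
  qed
qed

text \<open>Only the velocity at 0 matters. So a separate contraction for each small parameter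
  suffices, and all the regularity required of its fixed point is a little-o estimate at 0.\<close>

lemma level_set_curve:
  fixes F :: "'a::real_inner \<Rightarrow> 'b::real_inner"
  assumes B: "finite B" "\<forall>b\<in>B. \<forall>b'\<in>B. b \<bullet> b' = (if b = b' then 1 else 0)" "span B = (UNIV :: 'a set)"
    and C: "finite C" "\<forall>b\<in>C. \<forall>b'\<in>C. b \<bullet> b' = (if b = b' then 1 else 0)" "span C = (UNIV :: 'b set)"
    and S: "open S" "p \<in> S" and F: "Ck_on 1 F S"
    and surj: "surj (frechet_derivative F (at p))" and v: "frechet_derivative F (at p) v = 0"
  obtains \<gamma> :: "real \<Rightarrow> 'a" where "\<gamma> 0 = p" "(\<gamma> has_vector_derivative v) (at 0)"
    "\<forall>\<^sub>F \<tau> in nhds 0. \<gamma> \<tau> \<in> S \<and> F (\<gamma> \<tau>) = F p"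
proof -
  let ?D = "frechet_derivative F (at p)"
  have der: "(F has_derivative ?D) (at p)"
    using F S by (simp add: frechet_derivative_works)
  then have lin: "linear ?D" by (intro bounded_linear.linear has_derivative_bounded_linear)
  obtain r where r: "\<And>b. ?D (r b) = b" using surj by (metis surjD)
  \<comment> \<open>Choosing preimages of the basis vectors and extending linearly gives a linear
    right inverse of the derivative.\<close>
  define R where "R w = (\<Sum>b\<in>C. (w \<bullet> b) *\<^sub>R r b)" for w
  have R: "bounded_linear R"
    unfolding R_def by (intro bounded_linear_sum bounded_linear_compose[OF bounded_linear_scaleR_left]
      bounded_linear_inner_left)
  have DR: "?D (R w) = w" for w
    unfolding R_def linear_sum[OF lin] linear_scale[OF lin] r
    by (rule orthonormal_expansion[OF C])
  obtain K where K: "K > 0" "\<And>w. norm (R w) \<le> norm w * K"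
    using bounded_linear.pos_bounded[OF R] by blast
  obtain d where d: "d > 0" "ball p d \<subseteq> S"
    "\<And>x y. x \<in> ball p d \<Longrightarrow> y \<in> ball p d \<Longrightarrow>
       norm (F y - F x - ?D (y - x)) \<le> (1 / (2 * K)) * norm (y - x)"
    using Ck_on_strict_derivative[OF B S F, of "1 / (2 * K)"] K(1) by (metis zero_less_divide_1_iff zero_less_mult_iff zero_less_numeral)
  \<comment> \<open>With this radius \<open>R\<close> maps \<open>cball 0 \<rho>\<close> to vectors
    of norm below \<open>d / 2\<close>, which leaves the other half of \<open>d\<close> for the
    displacement along \<open>v\<close>.\<close>
  define \<rho> where "\<rho> = d / (4 * K)"
  have \<rho>: "\<rho> > 0" "\<rho> * K < d / 2" using d(1) K(1) by (auto simp: \<rho>_def field_simps)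
  \<comment> \<open>A fixed point \<open>w\<close> of \<open>T \<tau>\<close> corrects \<open>p + \<tau> v\<close> to the point \<open>p + \<tau> v + R w\<close> of the level set. As \<open>T \<tau>\<close>
    is a contraction and \<open>T \<tau> 0 = o(\<tau>)\<close>, the correction does not change the velocity.\<close>
  define T where "T \<tau> w = w - (F (p + \<tau> *\<^sub>R v + R w) - F p)" for \<tau> w
  \<comment> \<open>The second condition keeps \<open>T \<tau> 0\<close> within half the radius. The
    contraction factor 1/2 accounts for the other half, so \<open>T \<tau>\<close> maps the ball of
    radius \<open>\<rho>\<close> into itself.\<close>
  define good where "good \<tau> \<longleftrightarrow> norm (\<tau> *\<^sub>R v) < d / 2 \<and> norm (F (p + \<tau> *\<^sub>R v) - F p) < \<rho> / 2" for \<tau>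
  have Fv: "((\<lambda>\<tau>. F (p + \<tau> *\<^sub>R v)) has_derivative (\<lambda>_. 0)) (at 0)"
  proof -
    have "((\<lambda>\<tau>. p + \<tau> *\<^sub>R v) has_derivative (\<lambda>\<tau>. \<tau> *\<^sub>R v)) (at 0)"
      by (auto intro!: derivative_eq_intros)
    from diff_chain_at[OF this, of F ?D] der show ?thesis
      by (simp add: o_def linear_scale[OF lin] v)
  qed
  have good: "\<forall>\<^sub>F \<tau> in nhds 0. good \<tau>"
  proof -
    have "((\<lambda>\<tau>. norm (\<tau> *\<^sub>R v)) \<longlongrightarrow> 0) (nhds 0)"
      using isCont_tendsto_nhds[of 0 "\<lambda>\<tau>. norm (\<tau> *\<^sub>R v)"] by simp
    moreover have "((\<lambda>\<tau>. norm (F (p + \<tau> *\<^sub>R v) - F p)) \<longlongrightarrow> 0) (nhds 0)"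
    proof -
      have "isCont (\<lambda>\<tau>. norm (F (p + \<tau> *\<^sub>R v) - F p)) 0"
        using has_derivative_continuous[OF Fv] by (intro continuous_intros) auto
      then show ?thesis by (auto dest: isCont_tendsto_nhds)
    qed
    ultimately show ?thesis
      unfolding good_def using \<rho>(1) d(1)
      by (intro eventually_conj order_tendstoD(2)[where a = 0] order_tendstoD(2)) auto
  qed
  have fix_ex: "\<exists>w. p + \<tau> *\<^sub>R v + R w \<in> ball p d \<and> T \<tau> w = w \<and>
      norm w \<le> 2 * norm (F (p + \<tau> *\<^sub>R v) - F p)" if "good \<tau>" for \<tau>
  proof -
    have inb: "p + \<tau> *\<^sub>R v + R w \<in> ball p d" if "w \<in> cball 0 \<rho>" for w
    proof -
      have "norm (R w) \<le> \<rho> * K"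
        using K(2)[of w] that K(1) by (smt (verit) mem_cball_0 mult_right_mono)
      moreover have "norm (\<tau> *\<^sub>R v + R w) \<le> norm (\<tau> *\<^sub>R v) + norm (R w)" by (rule norm_triangle_ineq)
      moreover have "norm (\<tau> *\<^sub>R v) < d / 2" using \<open>good \<tau>\<close> by (simp add: good_def)
      ultimately have "norm (\<tau> *\<^sub>R v + R w) < d" using \<rho>(2) by linarith
      moreover have "dist p (p + \<tau> *\<^sub>R v + R w) = norm (\<tau> *\<^sub>R v + R w)"
        unfolding dist_norm by (subst norm_minus_commute) (simp add: algebra_simps)
      ultimately show ?thesis by simp
    qed
    have contr: "norm (T \<tau> w - T \<tau> w') \<le> 1 / 2 * norm (w - w')"
      if "w \<in> cball 0 \<rho>" "w' \<in> cball 0 \<rho>" for w w'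
    proof -
      let ?x = "p + \<tau> *\<^sub>R v + R w" and ?y = "p + \<tau> *\<^sub>R v + R w'"
      have yx: "?y - ?x = R (w' - w)" using linear_diff[OF bounded_linear.linear[OF R]] by simp
      \<comment> \<open>As \<open>R\<close> is a right inverse, the difference is exactly the
        linearization error of \<open>F\<close> between two points of the ball.\<close>
      have "T \<tau> w - T \<tau> w' = F ?y - F ?x - ?D (?y - ?x)"
        unfolding yx DR T_def by simp
      then have "norm (T \<tau> w - T \<tau> w') \<le> (1 / (2 * K)) * norm (?y - ?x)"
        using d(3)[OF inb[OF that(1)] inb[OF that(2)]] by simp
      also have "\<dots> \<le> (1 / (2 * K)) * (norm (w' - w) * K)"
        unfolding yx using K by (intro mult_left_mono) auto
      finally show ?thesis using K(1) by (simp add: norm_minus_commute)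
    qed
    have T0: "norm (T \<tau> 0) = norm (F (p + \<tau> *\<^sub>R v) - F p)"
      using linear_0[OF bounded_linear.linear[OF R]] by (simp add: T_def norm_minus_commute)
    have "\<exists>!w\<in>cball 0 \<rho>. T \<tau> w = w"
    proof (rule Banach_fix)
      show "complete (cball 0 \<rho> :: 'b set)"
        using complete_finite_orthonormal(2)[OF C] by (rule complete_closed_subset[rotated 2]) auto
      show "cball 0 \<rho> \<noteq> ({} :: 'b set)" using \<rho>(1) by auto
      show "(0::real) \<le> 1 / 2" "1 / 2 < (1::real)" by auto
      show "T \<tau> ` cball 0 \<rho> \<subseteq> cball 0 \<rho>"
      proof safe
        fix w :: 'b assume w: "w \<in> cball 0 \<rho>"
        have "norm (T \<tau> w) \<le> norm (T \<tau> w - T \<tau> 0) + norm (T \<tau> 0)"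
          using norm_triangle_ineq[of "T \<tau> w - T \<tau> 0" "T \<tau> 0"] by simp
        also have "norm (T \<tau> w - T \<tau> 0) \<le> 1 / 2 * norm w" using contr[OF w, of 0] \<rho>(1) by simp
        also have "norm (T \<tau> 0) \<le> \<rho> / 2" using \<open>good \<tau>\<close> unfolding T0 good_def by simp
        finally show "T \<tau> w \<in> cball 0 \<rho>" using w by simp
      qed
      show "dist (T \<tau> w) (T \<tau> w') \<le> 1 / 2 * dist w w'"
        if "w \<in> cball 0 \<rho>" "w' \<in> cball 0 \<rho>" for w w'
        using contr[OF that] by (simp add: dist_norm)
    qed
    then obtain w where w: "w \<in> cball 0 \<rho>" "T \<tau> w = w" by blast
    \<comment> \<open>The fixed point is its own image, so the contraction lets half of
      \<open>norm w\<close> be absorbed on the left.\<close>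
    have "norm w \<le> norm (T \<tau> w - T \<tau> 0) + norm (T \<tau> 0)"
      using norm_triangle_ineq[of "T \<tau> w - T \<tau> 0" "T \<tau> 0"] w(2) by simp
    also have "norm (T \<tau> w - T \<tau> 0) \<le> 1 / 2 * norm w" using contr[OF w(1), of 0] \<rho>(1) by simp
    finally have "norm w \<le> 2 * norm (F (p + \<tau> *\<^sub>R v) - F p)" unfolding T0 by simp
    then show ?thesis using w inb by blast
  qed
  \<comment> \<open>The default 0 keeps the bound \<open>W_le\<close> valid for every parameter, so
    the limit below needs no case distinction.\<close>
  define W where "W \<tau> = (if good \<tau> then SOME w. p + \<tau> *\<^sub>R v + R w \<in> ball p d \<and> T \<tau> w = w \<and>
      norm w \<le> 2 * norm (F (p + \<tau> *\<^sub>R v) - F p) else 0)" for \<tau>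
  have W: "p + \<tau> *\<^sub>R v + R (W \<tau>) \<in> ball p d" "T \<tau> (W \<tau>) = W \<tau>" if "good \<tau>" for \<tau>
    unfolding W_def using someI_ex[OF fix_ex[OF that]] that by auto
  have W_le: "norm (W \<tau>) \<le> 2 * norm (F (p + \<tau> *\<^sub>R v) - F p)" for \<tau>
    unfolding W_def using someI_ex[OF fix_ex, of \<tau>] by auto
  have W0: "W 0 = 0" using W_le[of 0] by simp
  have "(W has_derivative (\<lambda>_. 0)) (at 0)"
    unfolding has_derivative_at
  proof (intro conjI)
    \<comment> \<open>Because \<open>v\<close> is in the kernel of the derivative, \<open>F\<close>
      changes by little-o of the parameter along the straight line, and by \<open>W_le\<close> the
      same holds for \<open>W\<close>.\<close>
    have "((\<lambda>\<tau>. 2 * (norm (F (p + \<tau> *\<^sub>R v) - F p) / norm \<tau>)) \<longlongrightarrow> 2 * 0) (at 0)"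
      using Fv unfolding has_derivative_at by (intro tendsto_mult_left) simp
    then have "((\<lambda>\<tau>. 2 * (norm (F (p + \<tau> *\<^sub>R v) - F p) / norm \<tau>)) \<longlongrightarrow> 0) (at 0)" by simp
    then show "((\<lambda>h. norm (W (0 + h) - W 0 - 0) / norm h) \<longlongrightarrow> 0) (at 0)"
    proof (rule Lim_null_comparison[rotated])
      show "\<forall>\<^sub>F x in at 0. norm (norm (W (0 + x) - W 0 - 0) / norm x)
          \<le> 2 * (norm (F (p + x *\<^sub>R v) - F p) / norm x)"
      proof (rule always_eventually, rule allI)
        fix x :: real
        show "norm (norm (W (0 + x) - W 0 - 0) / norm x) \<le> 2 * (norm (F (p + x *\<^sub>R v) - F p) / norm x)"
          using W_le[of x] divide_right_mono[OF W_le[of x], of "norm x"] by (simp add: W0)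
      qed
    qed
  qed simp
  from bounded_linear.has_derivative[OF R this] have RW: "((\<lambda>\<tau>. R (W \<tau>)) has_vector_derivative 0) (at 0)"
    using linear_0[OF bounded_linear.linear[OF R]] by (simp add: has_vector_derivative_def)
  show thesis
  proof
    show "p + 0 *\<^sub>R v + R (W 0) = p" using linear_0[OF bounded_linear.linear[OF R]] by (simp add: W0)
    have "((\<lambda>\<tau>. p + \<tau> *\<^sub>R v) has_vector_derivative v) (at 0)"
      by (auto intro!: derivative_eq_intros simp: has_vector_derivative_def)
    from has_vector_derivative_add[OF this RW]
    show "((\<lambda>\<tau>. p + \<tau> *\<^sub>R v + R (W \<tau>)) has_vector_derivative v) (at 0)" by simp
    show "\<forall>\<^sub>F \<tau> in nhds 0. p + \<tau> *\<^sub>R v + R (W \<tau>) \<in> S \<and> F (p + \<tau> *\<^sub>R v + R (W \<tau>)) = F p"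
      using good
    proof eventually_elim
      case (elim \<tau>)
      show ?case using W[OF elim] d(2) by (auto simp: T_def)
    qed
  qed
qed

section \<open>Differentials of maps between manifolds\<close>

text \<open>The first-order content of \<open>smooth_manifold\<close>: enough for the chain rule,
  and easily checked for products and for the real line.\<close>

definition diff_atlas :: "('a::topological_space, 'e::real_normed_vector) atlas \<Rightarrow> bool" where
  "diff_atlas A \<longleftrightarrow>
     (\<forall>p. \<exists>c\<in>A. p \<in> fst c) \<and>
     (\<forall>c\<in>A. open (fst c) \<and> open (snd c ` fst c) \<and>
        homeomorphism (fst c) (snd c ` fst c) (snd c) (chart_inv c)) \<and>
     (\<forall>c\<in>A. \<forall>d\<in>A. \<forall>p\<in>fst c \<inter> fst d. (snd d \<circ> chart_inv c) differentiable (at (snd c p)))"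

text \<open>Continuity is included because the local expression carries no information where
  \<open>f\<close> leaves the domain of the chart chosen at \<open>f p\<close>.\<close>

definition mdifferentiable ::
    "('a::t2_space, 'e::real_normed_vector) atlas \<Rightarrow>
     ('b::topological_space, 'f::real_normed_vector) atlas \<Rightarrow> ('a \<Rightarrow> 'b) \<Rightarrow> 'a \<Rightarrow> bool" where
  "mdifferentiable A B f p \<longleftrightarrow> isCont f p \<and>
     (snd (chart_at B (f p)) \<circ> f \<circ> chart_inv (chart_at A p)) differentiable
       (at (snd (chart_at A p) p))"

lemma smooth_on_differentiable: "smooth_on f S \<Longrightarrow> x \<in> S \<Longrightarrow> f differentiable (at x)"
  unfolding smooth_on_def by (metis Ck_on.simps(2))

lemma smooth_manifold_diff_atlas:
  assumes "smooth_manifold A"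
  shows "diff_atlas A"
proof -
  have cov: "(\<Union>c\<in>A. fst c) = UNIV"
    using assms by (simp add: smooth_manifold_def)
  have ch: "\<forall>c\<in>A. open (fst c) \<and> open (snd c ` fst c) \<and>
        homeomorphism (fst c) (snd c ` fst c) (snd c) (chart_inv c)"
    using assms by (simp add: smooth_manifold_def)
  have tr: "\<forall>c\<in>A. \<forall>d\<in>A. smooth_on (snd d \<circ> chart_inv c) (snd c ` (fst c \<inter> fst d))"
    using assms by (simp add: smooth_manifold_def)
  show ?thesis
    unfolding diff_atlas_def
  proof (intro conjI ballI allI)
    fix p show "\<exists>c\<in>A. p \<in> fst c" using cov by blast
  next
    fix c d p assume "c \<in> A" "d \<in> A" "p \<in> fst c \<inter> fst d"
    then show "(snd d \<circ> chart_inv c) differentiable at (snd c p)"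
      using tr by (intro smooth_on_differentiable[where S = "snd c ` (fst c \<inter> fst d)"]) auto
  qed (use ch in auto)
qed

section \<open>Charts and neighbourhoods in coordinates\<close>

lemma chart_at:
  assumes "diff_atlas A"
  shows chart_at_mem: "chart_at A p \<in> A" and mem_chart_at: "p \<in> fst (chart_at A p)"
proof -
  have "\<exists>c. c \<in> A \<and> p \<in> fst c" using assms unfolding diff_atlas_def by blast
  from someI_ex[OF this] show "chart_at A p \<in> A" "p \<in> fst (chart_at A p)"
    by (simp_all add: chart_at_def)
qed

lemma chart_props:
  assumes "diff_atlas A" "c \<in> A"
  shows chart_open: "open (fst c)" and chart_image_open: "open (snd c ` fst c)"
    and chart_homeo: "homeomorphism (fst c) (snd c ` fst c) (snd c) (chart_inv c)"
  using assms by (auto simp: diff_atlas_def)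

lemma chart_transition:
  "diff_atlas A \<Longrightarrow> c \<in> A \<Longrightarrow> d \<in> A \<Longrightarrow> p \<in> fst c \<Longrightarrow> p \<in> fst d \<Longrightarrow>
    \<exists>D. (snd d \<circ> chart_inv c has_derivative D) (at (snd c p))"
  by (simp add: diff_atlas_def differentiable_def)

lemma chart_inv_chart: "diff_atlas A \<Longrightarrow> c \<in> A \<Longrightarrow> p \<in> fst c \<Longrightarrow> chart_inv c (snd c p) = p"
  using chart_homeo[of A c] by (simp add: homeomorphism_def)

lemma chart_eventually:
  assumes "diff_atlas A" "c \<in> A" "p \<in> fst c"
  shows "\<forall>\<^sub>F y in nhds (snd c p). y \<in> snd c ` fst c"
  using assms by (simp add: eventually_nhds_in_open[OF chart_image_open])

lemma isCont_chart_inv: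
  fixes A :: "('a::t2_space, 'e::real_normed_vector) atlas"
  assumes "diff_atlas A" "c \<in> A" "p \<in> fst c"
  shows "isCont (chart_inv c) (snd c p)"
  using chart_props[OF assms(1,2)] assms(3)
  by (auto simp: homeomorphism_def continuous_on_eq_continuous_at)

lemma eventually_isCont:
  "isCont f p \<Longrightarrow> open U \<Longrightarrow> f p \<in> U \<Longrightarrow> \<forall>\<^sub>F x in nhds p. f x \<in> U"
  using isCont_tendsto_nhds topological_tendstoD by blast

lemma eventually_chart_inv:
  fixes A :: "('a::t2_space, 'e::real_normed_vector) atlas"
  assumes "diff_atlas A" "c \<in> A" "p \<in> fst c" and "\<forall>\<^sub>F x in nhds p. P x"
  shows "\<forall>\<^sub>F y in nhds (snd c p). P (chart_inv c y)"
  using isCont_tendsto_nhds[OF isCont_chart_inv[OF assms(1-3)]] assms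
  by (simp add: chart_inv_chart filterlim_iff)

lemma has_derivative_cong_nhds:
  assumes "(f has_derivative D) (at x)" "\<forall>\<^sub>F y in nhds x. f y = g y"
  shows "(g has_derivative D) (at x)"
proof (rule has_derivative_transform_eventually[OF assms(1)])
  show "\<forall>\<^sub>F y in at x. f y = g y"
    using assms(2) by (auto simp: eventually_at_filter elim: eventually_mono)
qed (use eventually_nhds_x_imp_x[OF assms(2)] in auto)

text \<open>The intermediate chart \<open>d\<close> cancels only where \<open>f\<close> stays in its
  domain, which continuity ensures near \<open>p\<close>. With \<open>id\<close> as one of the two
  maps this is a change of charts.\<close>

lemma chart_comp_derivative:
  fixes A :: "('a::t2_space, 'e::real_normed_vector) atlas"
    and B :: "('b::t2_space, 'f::real_normed_vector) atlas"
    and C :: "('c set \<times> ('c \<Rightarrow> 'h::real_normed_vector))"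
  assumes "diff_atlas A" "c \<in> A" "p \<in> fst c" "diff_atlas B" "d \<in> B" "f p \<in> fst d" "isCont f p"
    and f: "(snd d \<circ> f \<circ> chart_inv c has_derivative D) (at (snd c p))"
    and g: "(snd C \<circ> g \<circ> chart_inv d has_derivative E) (at (snd d (f p)))"
  shows "(snd C \<circ> (g \<circ> f) \<circ> chart_inv c has_derivative E \<circ> D) (at (snd c p))"
proof (rule has_derivative_cong_nhds)
  show "((snd C \<circ> g \<circ> chart_inv d) \<circ> (snd d \<circ> f \<circ> chart_inv c) has_derivative E \<circ> D) (at (snd c p))"
    using f g by (intro diff_chain_at) (simp_all add: chart_inv_chart[OF assms(1-3)])
  have "\<forall>\<^sub>F y in nhds (snd c p). f (chart_inv c y) \<in> fst d"
    using assms chart_open[OF assms(4,5)]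
    by (intro eventually_chart_inv[OF assms(1-3)] eventually_isCont)
  then show "\<forall>\<^sub>F y in nhds (snd c p). ((snd C \<circ> g \<circ> chart_inv d) \<circ> (snd d \<circ> f \<circ> chart_inv c)) y =
      (snd C \<circ> (g \<circ> f) \<circ> chart_inv c) y"
    by eventually_elim (simp add: chart_inv_chart[OF assms(4,5)])
qed

section \<open>The differential and the chain rule\<close>

lemma mdiff_has_derivative:
  "mdifferentiable A B f p \<Longrightarrow>
    (snd (chart_at B (f p)) \<circ> f \<circ> chart_inv (chart_at A p) has_derivative mdiff A B f p)
      (at (snd (chart_at A p) p))"
  unfolding mdifferentiable_def mdiff_def frechet_derivative_works by simp

lemma mdiffI:
  assumes "isCont f p" and
    "(snd (chart_at B (f p)) \<circ> f \<circ> chart_inv (chart_at A p) has_derivative D)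
      (at (snd (chart_at A p) p))"
  shows "mdifferentiable A B f p" "mdiff A B f p = D"
  using assms frechet_derivative_at[OF assms(2)]
  by (auto simp: mdifferentiable_def mdiff_def[abs_def] differentiable_def)

lemma linear_mdiff: "mdifferentiable A B f p \<Longrightarrow> linear (mdiff A B f p)"
  by (intro bounded_linear.linear has_derivative_bounded_linear[OF mdiff_has_derivative])

text \<open>Local expressions in different charts differ by transition maps, which are inserted
  first on the target side and then on the source side.\<close>

lemma mdifferentiableI:
  fixes A :: "('a::t2_space, 'e::real_normed_vector) atlas"
    and B :: "('b::t2_space, 'f::real_normed_vector) atlas"
  assumes A: "diff_atlas A" "c \<in> A" "p \<in> fst c" and B: "diff_atlas B" "d \<in> B" "f p \<in> fst d"
    and f: "isCont f p" "(snd d \<circ> f \<circ> chart_inv c) differentiable (at (snd c p))"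
  shows "mdifferentiable A B f p"
proof -
  let ?a = "chart_at A p" and ?b = "chart_at B (f p)"
  note a = chart_at_mem[OF A(1)] mem_chart_at[OF A(1)] and b = chart_at_mem[OF B(1)] mem_chart_at[OF B(1)]
  obtain D where D: "(snd d \<circ> f \<circ> chart_inv c has_derivative D) (at (snd c p))"
    using f(2) by (auto simp: differentiable_def)
  obtain E where E: "(snd c \<circ> id \<circ> chart_inv ?a has_derivative E) (at (snd ?a p))"
    using chart_transition[OF A(1) a(1) A(2) a(2) A(3)] by auto
  obtain H where H: "(snd ?b \<circ> id \<circ> chart_inv d has_derivative H) (at (snd d (f p)))"
    using chart_transition[OF B(1,2) b(1) B(3) b(2)] by auto
  have "(snd ?b \<circ> (id \<circ> f) \<circ> chart_inv c has_derivative H \<circ> D) (at (snd c p))"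
    by (rule chart_comp_derivative[OF A B f(1) D H])
  then have "(snd ?b \<circ> ((id \<circ> f) \<circ> id) \<circ> chart_inv ?a has_derivative (H \<circ> D) \<circ> E) (at (snd ?a p))"
    using A E by (intro chart_comp_derivative[OF A(1) a A(1,2)]) auto
  then show ?thesis using f(1) by (intro mdiffI) auto
qed

lemma mdiff_compose:
  fixes A :: "('a::t2_space, 'e::real_normed_vector) atlas"
    and B :: "('b::t2_space, 'f::real_normed_vector) atlas"
    and C :: "('c::t2_space, 'h::real_normed_vector) atlas"
  assumes A: "diff_atlas A" and B: "diff_atlas B"
    and f: "mdifferentiable A B f p" and g: "mdifferentiable B C g (f p)"
  shows mdifferentiable_compose: "mdifferentiable A C (\<lambda>x. g (f x)) p"
    and "mdiff A C (\<lambda>x. g (f x)) p v = mdiff B C g (f p) (mdiff A B f p v)"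
proof -
  have "(snd (chart_at C (g (f p))) \<circ> (g \<circ> f) \<circ> chart_inv (chart_at A p) has_derivative
      mdiff B C g (f p) \<circ> mdiff A B f p) (at (snd (chart_at A p) p))"
    using f by (intro chart_comp_derivative[OF A chart_at[OF A] B chart_at[OF B]]
      mdiff_has_derivative f g) (simp add: mdifferentiable_def)
  moreover have "isCont (\<lambda>x. g (f x)) p"
    using f g by (auto simp: mdifferentiable_def intro: isCont_o2[of p f g])
  ultimately show "mdifferentiable A C (\<lambda>x. g (f x)) p"
    and "mdiff A C (\<lambda>x. g (f x)) p v = mdiff B C g (f p) (mdiff A B f p v)"
    using mdiffI[where f = "\<lambda>x. g (f x)" and p = p and A = A and B = C
        and D = "mdiff B C g (f p) \<circ> mdiff A B f p"] by (simp_all add: o_def)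
qed

lemma mdiff_cong:
  fixes A :: "('a::t2_space, 'e::real_normed_vector) atlas"
  assumes A: "diff_atlas A" and f: "mdifferentiable A B f p" and eq: "\<forall>\<^sub>F x in nhds p. f x = g x"
  shows "mdifferentiable A B g p" "mdiff A B g p = mdiff A B f p"
proof -
  have p: "g p = f p" using eventually_nhds_x_imp_x[OF eq] by simp
  have "isCont g p" using f isCont_cong[OF eq] by (simp add: mdifferentiable_def)
  moreover have "(snd (chart_at B (g p)) \<circ> g \<circ> chart_inv (chart_at A p) has_derivative
      mdiff A B f p) (at (snd (chart_at A p) p))"
    unfolding p
    by (rule has_derivative_cong_nhds[OF mdiff_has_derivative[OF f]])
      (use eventually_chart_inv[OF A chart_at[OF A] eq] in \<open>auto elim: eventually_mono\<close>)
  ultimately show "mdifferentiable A B g p" "mdiff A B g p = mdiff A B f p"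
    by (auto intro: mdiffI)
qed

lemma mdiff_const:
  "mdifferentiable A B (\<lambda>x. q) p" "mdiff A B (\<lambda>x. q) p = (\<lambda>v. 0)"
  using mdiffI[where f = "\<lambda>x. q" and p = p and A = A and B = B and D = "\<lambda>v. 0"]
  by (simp_all add: o_def)

lemma mdiff_ident:
  fixes A :: "('a::t2_space, 'e::real_normed_vector) atlas"
  assumes A: "diff_atlas A"
  shows "mdifferentiable A A (\<lambda>x. x) p" "mdiff A A (\<lambda>x. x) p = (\<lambda>v. v)"
proof -
  have "(snd (chart_at A p) \<circ> (\<lambda>x. x) \<circ> chart_inv (chart_at A p) has_derivative (\<lambda>v. v))
      (at (snd (chart_at A p) p))"
    by (rule has_derivative_cong_nhds[OF has_derivative_ident])
      (use chart_eventually[OF A chart_at[OF A], of p] in \<open>auto elim!: eventually_mono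
         simp: chart_inv_chart[OF A chart_at_mem[OF A]]\<close>)
  then show "mdifferentiable A A (\<lambda>x. x) p" "mdiff A A (\<lambda>x. x) p = (\<lambda>v. v)"
    by (auto intro: mdiffI)
qed

lemma smooth_map_on_mdifferentiable:
  fixes A :: "('a::t2_space, 'e::real_normed_vector) atlas"
    and B :: "('b::t2_space, 'f::real_normed_vector) atlas"
  assumes "diff_atlas A" "diff_atlas B" "smooth_map_on A B W f" "p \<in> W"
  shows "mdifferentiable A B f p"
proof (rule mdifferentiableI[OF assms(1) chart_at[OF assms(1)] assms(2) chart_at[OF assms(2)]])
  show "isCont f p" 
    using assms(3,4) continuous_on_eq_continuous_at[of W f] by (auto simp: smooth_map_on_def)
  let ?a = "chart_at A p" and ?b = "chart_at B (f p)"
  have "smooth_on (snd ?b \<circ> f \<circ> chart_inv ?a) (snd ?a ` (fst ?a \<inter> W \<inter> f -` fst ?b))"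
    using assms(3) chart_at_mem[OF assms(1)] chart_at_mem[OF assms(2)] by (simp add: smooth_map_on_def)
  then show "(snd ?b \<circ> f \<circ> chart_inv ?a) differentiable at (snd ?a p)"
    by (rule smooth_on_differentiable) (use assms(4) mem_chart_at[OF assms(1)] mem_chart_at[OF assms(2)] in simp)
qed

section \<open>Products\<close>

lemma chart_inv_prod:
  assumes "inj_on (snd c) (fst c)" "inj_on (snd d) (fst d)" "y \<in> snd c ` fst c" "z \<in> snd d ` fst d"
  shows "chart_inv (fst c \<times> fst d, map_prod (snd c) (snd d)) (y, z) = (chart_inv c y, chart_inv d z)"
  unfolding chart_inv_def fst_conv snd_conv using assms
  by (intro inv_into_f_eq map_prod_inj_on) (auto simp: inv_into_into f_inv_into_f)

lemma chart_inj: "diff_atlas A \<Longrightarrow> c \<in> A \<Longrightarrow> inj_on (snd c) (fst c)"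
  by (metis chart_inv_chart inj_on_inverseI)

lemma prod_chart_mem:
  "c \<in> A \<Longrightarrow> d \<in> B \<Longrightarrow> (fst c \<times> fst d, map_prod (snd c) (snd d)) \<in> prod_atlas A B"
  unfolding prod_atlas_def by force

lemma chart_inv_prod_eventually:
  assumes "diff_atlas A" "c \<in> A" "p \<in> fst c" "diff_atlas B" "d \<in> B" "q \<in> fst d"
  shows "\<forall>\<^sub>F y in nhds (snd c p, snd d q). y \<in> snd c ` fst c \<times> snd d ` fst d \<and>
    chart_inv (fst c \<times> fst d, map_prod (snd c) (snd d)) y =
    map_prod (chart_inv c) (chart_inv d) y"
proof -
  have "\<forall>\<^sub>F y in nhds (snd c p, snd d q). y \<in> snd c ` fst c \<times> snd d ` fst d"
    using assms chart_image_open[OF assms(1,2)] chart_image_open[OF assms(4,5)]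
    by (intro eventually_nhds_in_open open_Times) auto
  then show ?thesis
    by eventually_elim
      (auto simp: chart_inv_prod[OF chart_inj[OF assms(1,2)] chart_inj[OF assms(4,5)]])
qed

lemma diff_atlas_prod:
  fixes A :: "('a::t2_space, 'e::real_normed_vector) atlas"
    and B :: "('b::t2_space, 'f::real_normed_vector) atlas"
  assumes A: "diff_atlas A" and B: "diff_atlas B"
  shows "diff_atlas (prod_atlas A B)"
  unfolding diff_atlas_def
proof (intro conjI ballI allI)
  fix p :: "'a \<times> 'b"
  show "\<exists>c\<in>prod_atlas A B. p \<in> fst c"
    using prod_chart_mem[OF chart_at_mem[OF A, of "fst p"] chart_at_mem[OF B, of "snd p"]]
      mem_chart_at[OF A, of "fst p"] mem_chart_at[OF B, of "snd p"]
    by (metis SigmaI fst_conv prod.collapse)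
next
  fix e assume "e \<in> prod_atlas A B"
  then obtain c d where cd: "c \<in> A" "d \<in> B" and e: "e = (fst c \<times> fst d, map_prod (snd c) (snd d))"
    unfolding prod_atlas_def by auto
  note c = chart_props[OF A cd(1)] and d = chart_props[OF B cd(2)]
  have im: "snd e ` fst e = snd c ` fst c \<times> snd d ` fst d"
    unfolding e by (auto simp: map_prod_def image_paired_Times)
  show "open (fst e)" using c d by (auto simp: e open_Times)
  show "open (snd e ` fst e)" unfolding im using c d by (auto simp: open_Times)
  have inv: "chart_inv e y = map_prod (chart_inv c) (chart_inv d) y" if "y \<in> snd e ` fst e" for y
    using that unfolding im e
    by (cases y) (auto simp: chart_inv_prod[OF chart_inj[OF A cd(1)] chart_inj[OF B cd(2)]])
  have cont: "continuous_on (fst c \<times> fst d) (map_prod (snd c) (snd d))"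
    "continuous_on (snd e ` fst e) (map_prod (chart_inv c) (chart_inv d))"
    unfolding im using c(3) d(3)
    by (auto simp: homeomorphism_def map_prod_def split_beta
        intro!: continuous_on_Pair continuous_on_compose2[OF _ continuous_on_fst[OF continuous_on_id]]
          continuous_on_compose2[OF _ continuous_on_snd[OF continuous_on_id]])
  show "homeomorphism (fst e) (snd e ` fst e) (snd e) (chart_inv e)"
  proof (rule homeomorphismI)
    show "continuous_on (fst e) (snd e)" using cont by (simp add: e)
    show "continuous_on (snd e ` fst e) (chart_inv e)"
      using cont(2) inv by (simp cong: continuous_on_cong)
    show inv': "chart_inv e (snd e x) = x" if "x \<in> fst e" for x
      using that inv[of "snd e x"] chart_inv_chart[OF A cd(1)] chart_inv_chart[OF B cd(2)] by (auto simp: e)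
    show "chart_inv e ` snd e ` fst e \<subseteq> fst e" using inv' by auto
    show "snd e (chart_inv e y) = y" if "y \<in> snd e ` fst e" for y using that inv' by auto
  qed auto
next
  fix e f p assume "e \<in> prod_atlas A B" "f \<in> prod_atlas A B" and p: "p \<in> fst e \<inter> fst f"
  then obtain c d c' d' where cd: "c \<in> A" "d \<in> B" and e: "e = (fst c \<times> fst d, map_prod (snd c) (snd d))"
    and cd': "c' \<in> A" "d' \<in> B" and f: "f = (fst c' \<times> fst d', map_prod (snd c') (snd d'))"
    unfolding prod_atlas_def by auto
  obtain D where D: "((snd c' \<circ> chart_inv c) has_derivative D) (at (snd c (fst p)))"
    using chart_transition[OF A cd(1) cd'(1), of "fst p"] p by (auto simp: e f)
  obtain E where E: "((snd d' \<circ> chart_inv d) has_derivative E) (at (snd d (snd p)))"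
    using chart_transition[OF B cd(2) cd'(2), of "snd p"] p by (auto simp: e f)
  have p': "snd e p = (snd c (fst p), snd d (snd p))" by (cases p) (simp add: e)
  have "((\<lambda>y. ((snd c' \<circ> chart_inv c) (fst y), (snd d' \<circ> chart_inv d) (snd y))) has_derivative
      (\<lambda>v. (D (fst v), E (snd v)))) (at (snd e p))"
    unfolding p' using D E
    by (intro has_derivative_Pair has_derivative_compose[of fst fst _ _ "snd c' \<circ> chart_inv c" D]
      has_derivative_compose[of snd snd _ _ "snd d' \<circ> chart_inv d" E] has_derivative_fst
      has_derivative_snd has_derivative_ident) auto
  then have "((snd f \<circ> chart_inv e) has_derivative (\<lambda>v. (D (fst v), E (snd v)))) (at (snd e p))"
  proof (rule has_derivative_cong_nhds)
    have "\<forall>\<^sub>F y in nhds (snd e p). chart_inv e y = map_prod (chart_inv c) (chart_inv d) y"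
      using chart_inv_prod_eventually[OF A cd(1) _ B cd(2), of "fst p" "snd p"] p unfolding p'
      by (auto simp: e elim: eventually_mono)
    then show "\<forall>\<^sub>F y in nhds (snd e p). ((snd c' \<circ> chart_inv c) (fst y), (snd d' \<circ> chart_inv d) (snd y)) =
        (snd f \<circ> chart_inv e) y"
      by eventually_elim (auto simp: f map_prod_def split_beta)
  qed
  then show "(snd f \<circ> chart_inv e) differentiable at (snd e p)" by (auto simp: differentiable_def)
qed

text \<open>In product charts the projections become the linear maps \<open>fst\<close> and
  \<open>snd\<close>.\<close>

lemma mdifferentiable_fst_snd:
  fixes A :: "('a::t2_space, 'e::real_normed_vector) atlas"
    and B :: "('b::t2_space, 'f::real_normed_vector) atlas"
  assumes A: "diff_atlas A" and B: "diff_atlas B"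
  shows mdifferentiable_fst: "mdifferentiable (prod_atlas A B) A fst p"
    and mdifferentiable_snd: "mdifferentiable (prod_atlas A B) B snd p"
proof -
  obtain x y where p: "p = (x, y)" by fastforce
  let ?a = "chart_at A x" and ?b = "chart_at B y"
  let ?c = "(fst ?a \<times> fst ?b, map_prod (snd ?a) (snd ?b))"
  note a = chart_at[OF A, of x] and b = chart_at[OF B, of y]
  have ev: "\<forall>\<^sub>F z in nhds (snd ?a x, snd ?b y). fst z = (snd ?a \<circ> fst \<circ> chart_inv ?c) z \<and>
       snd z = (snd ?b \<circ> snd \<circ> chart_inv ?c) z"
    using chart_inv_prod_eventually[OF A a B b]
    by eventually_elim (auto simp: chart_inv_chart[OF A a(1)] chart_inv_chart[OF B b(1)])
  have "(snd ?a \<circ> fst \<circ> chart_inv ?c has_derivative fst) (at (snd ?a x, snd ?b y))"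
    by (rule has_derivative_cong_nhds[of fst]) (use ev in \<open>auto elim: eventually_mono
      intro: bounded_linear_imp_has_derivative bounded_linear_fst\<close>)
  moreover have "(snd ?b \<circ> snd \<circ> chart_inv ?c has_derivative snd) (at (snd ?a x, snd ?b y))"
    by (rule has_derivative_cong_nhds[of snd]) (use ev in \<open>auto elim: eventually_mono
      intro: bounded_linear_imp_has_derivative bounded_linear_snd\<close>)
  ultimately show "mdifferentiable (prod_atlas A B) A fst p" "mdifferentiable (prod_atlas A B) B snd p"
    unfolding p using a b prod_chart_mem[OF a(1) b(1)]
    by (auto intro!: mdifferentiableI[OF diff_atlas_prod[OF A B], of ?c _ _ ?a]
        mdifferentiableI[OF diff_atlas_prod[OF A B], of ?c _ _ ?b] A B
        simp: differentiable_def continuous_fst continuous_snd)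
qed

lemma mdifferentiable_Pair:
  fixes N :: "('n::t2_space, 'e::real_normed_vector) atlas"
    and A :: "('a::t2_space, 'f::real_normed_vector) atlas"
    and B :: "('b::t2_space, 'h::real_normed_vector) atlas"
  assumes N: "diff_atlas N" and A: "diff_atlas A" and B: "diff_atlas B"
    and f: "mdifferentiable N A f x" and g: "mdifferentiable N B g x"
  shows "mdifferentiable N (prod_atlas A B) (\<lambda>x. (f x, g x)) x"
proof (rule mdifferentiableI[OF N chart_at[OF N] diff_atlas_prod[OF A B]
      prod_chart_mem[OF chart_at_mem[OF A, of "f x"] chart_at_mem[OF B, of "g x"]]])
  show "isCont (\<lambda>x. (f x, g x)) x"
    using f g by (intro continuous_Pair) (auto simp: mdifferentiable_def)
  have "((\<lambda>y. ((snd (chart_at A (f x)) \<circ> f \<circ> chart_inv (chart_at N x)) y,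
      (snd (chart_at B (g x)) \<circ> g \<circ> chart_inv (chart_at N x)) y)) has_derivative
      (\<lambda>v. (mdiff N A f x v, mdiff N B g x v))) (at (snd (chart_at N x) x))"
    by (intro has_derivative_Pair mdiff_has_derivative f g)
  then show "(snd (fst (chart_at A (f x)) \<times> fst (chart_at B (g x)),
      map_prod (snd (chart_at A (f x))) (snd (chart_at B (g x)))) \<circ>
      (\<lambda>x. (f x, g x)) \<circ> chart_inv (chart_at N x)) differentiable at (snd (chart_at N x) x)"
    by (auto simp: differentiable_def o_def)
qed (use mem_chart_at[OF A] mem_chart_at[OF B] in simp)

text \<open>The chart chosen at a pair need not be the product of the charts chosen at its
  components, so a tangent vector of the product is accessed only through the differentials of the
  projections.\<close>

lemma mdiff_Pair:
  fixes N :: "('n::t2_space, 'e::real_normed_vector) atlas"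
    and A :: "('a::t2_space, 'f::real_normed_vector) atlas"
    and B :: "('b::t2_space, 'h::real_normed_vector) atlas"
  assumes N: "diff_atlas N" and A: "diff_atlas A" and B: "diff_atlas B"
    and f: "mdifferentiable N A f x" and g: "mdifferentiable N B g x"
  shows "mdiff (prod_atlas A B) A fst (f x, g x) (mdiff N (prod_atlas A B) (\<lambda>x. (f x, g x)) x v) =
      mdiff N A f x v"
    and "mdiff (prod_atlas A B) B snd (f x, g x) (mdiff N (prod_atlas A B) (\<lambda>x. (f x, g x)) x v) =
      mdiff N B g x v"
  using mdiff_compose(2)[OF N diff_atlas_prod[OF A B] mdifferentiable_Pair[OF assms]
      mdifferentiable_fst[OF A B], of v]
    mdiff_compose(2)[OF N diff_atlas_prod[OF A B] mdifferentiable_Pair[OF assms]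
      mdifferentiable_snd[OF A B], of v] by simp_all

section \<open>Curves in fibres\<close>

text \<open>One global chart, in which the velocity of a curve \<open>c\<close> at 0 is
  \<open>mdiff real_atlas A c 0 1\<close>.\<close>

definition real_atlas :: "(real, real) atlas" where
  "real_atlas = {(UNIV, \<lambda>x. x)}"

lemma real_chart: "chart_at real_atlas x = (UNIV, \<lambda>x. x)" "chart_inv (UNIV, \<lambda>x::real. x) = (\<lambda>x. x)"
  by (auto simp: chart_at_def real_atlas_def chart_inv_def inv_into_def)

lemma diff_atlas_real: "diff_atlas real_atlas"
  by (auto simp: diff_atlas_def real_atlas_def real_chart o_def homeomorphism_ident)

text \<open>The curve comes from \<open>level_set_curve\<close> applied to the local expression of
  \<open>s\<close> and is carried back by the inverse chart.\<close>

lemma submersion_fibre_curve: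
  fixes A :: "('a::{t2_space, second_countable_topology}, 'e::real_inner) atlas"
    and B :: "('b::{t2_space, second_countable_topology}, 'f::real_inner) atlas"
  assumes A: "smooth_manifold A" and B: "smooth_manifold B" and s: "smooth_map_on A B UNIV s"
    and surj: "surj (mdiff A B s g)" and X: "mdiff A B s g X = 0"
  obtains c where "c 0 = g" "mdifferentiable real_atlas A c 0" "mdiff real_atlas A c 0 1 = X"
    "\<forall>\<^sub>F \<tau> in nhds 0. s (c \<tau>) = s g"
proof -
  note A' = smooth_manifold_diff_atlas[OF A] and B' = smooth_manifold_diff_atlas[OF B]
  let ?a = "chart_at A g" and ?b = "chart_at B (s g)"
  note a = chart_at[OF A', of g] and b = chart_at[OF B', of "s g"]
  let ?F = "snd ?b \<circ> s \<circ> chart_inv ?a" and ?U = "fst ?a \<inter> s -` fst ?b"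
  let ?S = "snd ?a ` ?U"
  obtain E :: "'e set" where E: "finite E" "\<forall>b\<in>E. \<forall>b'\<in>E. b \<bullet> b' = (if b = b' then 1 else 0)" "span E = UNIV"
    using A unfolding smooth_manifold_def by blast
  obtain H :: "'f set" where H: "finite H" "\<forall>b\<in>H. \<forall>b'\<in>H. b \<bullet> b' = (if b = b' then 1 else 0)" "span H = UNIV"
    using B unfolding smooth_manifold_def by blast
  have "smooth_on ?F (snd ?a ` (fst ?a \<inter> UNIV \<inter> s -` fst ?b))"
    using s a b by (simp add: smooth_map_on_def)
  then have F: "Ck_on 1 ?F ?S" by (simp add: smooth_on_def)
  have "open ?U"
    using s chart_open[OF A' a(1)] chart_open[OF B' b(1)] by (auto simp: smooth_map_on_def intro: open_vimage)
  then have "openin (top_of_set (snd ?a ` fst ?a)) ?S"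
    by (intro homeomorphism_imp_open_map[OF chart_homeo[OF A' a(1)]] open_subset) auto
  then have S: "open ?S" using chart_image_open[OF A' a(1)] by (simp add: openin_open_eq)
  have gS: "snd ?a g \<in> ?S" using a b by auto
  obtain \<gamma> where \<gamma>: "\<gamma> 0 = snd ?a g" "(\<gamma> has_vector_derivative X) (at 0)"
    "\<forall>\<^sub>F \<tau> in nhds 0. \<gamma> \<tau> \<in> ?S \<and> ?F (\<gamma> \<tau>) = ?F (snd ?a g)"
    using level_set_curve[OF E H S gS F, of X] surj X unfolding mdiff_def[abs_def] by blast
  have c0: "chart_inv ?a (\<gamma> 0) = g" using a by (simp add: \<gamma> chart_inv_chart[OF A'])
  have "isCont (chart_inv ?a) (\<gamma> 0)"
    unfolding \<gamma> using isCont_chart_inv[OF A' a] .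
  moreover have "isCont \<gamma> 0"
    using \<gamma>(2) by (rule has_vector_derivative_continuous)
  ultimately have cont: "isCont (\<lambda>\<tau>. chart_inv ?a (\<gamma> \<tau>)) 0" by (rule isCont_o2[rotated])
  have "(snd ?a \<circ> (\<lambda>\<tau>. chart_inv ?a (\<gamma> \<tau>)) has_derivative (\<lambda>t. t *\<^sub>R X)) (at 0)"
    by (rule has_derivative_cong_nhds[OF \<gamma>(2)[unfolded has_vector_derivative_def]])
      (use \<gamma>(3) in \<open>auto elim!: eventually_mono simp: chart_inv_chart[OF A' a(1)]\<close>)
  then have "(snd (chart_at A (chart_inv ?a (\<gamma> 0))) \<circ> (\<lambda>\<tau>. chart_inv ?a (\<gamma> \<tau>)) \<circ> chart_inv (chart_at real_atlas 0)
      has_derivative (\<lambda>t. t *\<^sub>R X)) (at (snd (chart_at real_atlas 0) 0))"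
    unfolding c0 real_chart by (simp add: o_def)
  note mdiffI[OF cont this]
  moreover have "\<forall>\<^sub>F \<tau> in nhds 0. s (chart_inv ?a (\<gamma> \<tau>)) = s g"
    using \<gamma>(3)
  proof eventually_elim
    \<comment> \<open>The restriction to \<open>?S\<close> keeps the values of \<open>s\<close> in
      the domain of \<open>?b\<close>, so equal coordinates mean equal points by injectivity of the
      chart.\<close>
    case (elim \<tau>)
    then obtain q where "\<gamma> \<tau> = snd ?a q" "q \<in> fst ?a" "s q \<in> fst ?b" by auto
    with elim a b show ?case
      using inj_onD[OF chart_inj[OF B' b(1)]] by (simp add: chart_inv_chart[OF A'])
  qed
  ultimately show thesis using c0 by (intro that) auto
qed

section \<open>Alternating forms\<close>

lemma alternating_form_linear:
  "alternating_form r f \<Longrightarrow> length vs = r \<Longrightarrow> i < r \<Longrightarrow> linear (\<lambda>v. f (vs[i := v]))"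
  by (simp add: alternating_form_def)

lemma alternating_form_zero:
  assumes "alternating_form (Suc r) f" "length vs = r"
  shows "f (0 # vs) = 0"
  using linear_0[OF alternating_form_linear[OF assms(1), of "0 # vs" 0]] assms(2) by simp

text \<open>Polarization: expand the vanishing value with \<open>a + b\<close> in both
  places.\<close>

lemma alternating_form_swap:
  assumes f: "alternating_form r f" and vs: "length vs = r" and ij: "i < r" "j < r" "i \<noteq> j"
  shows "f (vs[i := a, j := b]) = - f (vs[i := b, j := a])"
proof -
  have eq0: "f (vs[i := x, j := x]) = 0" for x
    using f vs ij by (simp add: alternating_form_def)
  have addj: "f (vs[i := x, j := y + z]) = f (vs[i := x, j := y]) + f (vs[i := x, j := z])" for x y z
    using linear_add[OF alternating_form_linear[OF f, of "vs[i := x]" j]] vs ij by simp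
  have addi: "f (vs[i := y + z, j := x]) = f (vs[i := y, j := x]) + f (vs[i := z, j := x])" for x y z
    using linear_add[OF alternating_form_linear[OF f, of "vs[j := x]" i]] vs ij
    by (simp add: list_update_swap)
  show ?thesis using eq0[of "a + b"] eq0[of a] eq0[of b] unfolding addi addj by linarith
qed

text \<open>At most two transpositions bring the entries \<open>i\<close> and \<open>j\<close> to
  the front, each changing only the sign.\<close>

lemma alternating_form_eq_0:
  assumes f: "alternating_form r f" and vs: "length vs = r" and ij: "i < r" "j < r" "i \<noteq> j"
    and 0: "\<And>ws. Suc (Suc (length ws)) = r \<Longrightarrow> f (vs ! i # vs ! j # ws) = 0"
  shows "f vs = 0"
proof -
  have swap: "f ws = - f (ws[p := ws ! q, q := ws ! p])"
    if "length ws = r" "p < r" "q < r" "p \<noteq> q" for ws p q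
    using alternating_form_swap[OF f that, of "ws ! p" "ws ! q"] by simp
  have head: "f ws = 0" if ws: "length ws = r" "ws ! 0 = vs ! i" "ws ! 1 = vs ! j" for ws
  proof -
    obtain x y zs where "ws = x # y # zs" using ws(1) ij by (cases ws; cases "tl ws") auto
    then show ?thesis using 0[of zs] ws by simp
  qed
  have first: "f ws = 0" if ws: "length ws = r" "ws ! 0 = vs ! i" "l < r" "l \<noteq> 0" "ws ! l = vs ! j" for ws l
  proof (cases "l = 1")
    case False
    then show ?thesis
      using head[of "ws[1 := ws ! l, l := ws ! 1]"] swap[of ws 1 l] ws by simp
  qed (use head ws in simp)
  show ?thesis
  proof (cases "i = 0")
    case True
    then show ?thesis using first[of vs j] vs ij by simp
  next
    case False
    \<comment> \<open>If \<open>j\<close> is 0, the first transposition has moved its entry to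
      position \<open>i\<close>.\<close>
    then show ?thesis
      using first[of "vs[0 := vs ! i, i := vs ! 0]" "if j = 0 then i else j"] swap[of vs 0 i] vs ij
      by (auto simp: nth_list_update split: if_splits)
  qed
qed

text \<open>The entries are replaced one at a time from the left, so invariance under a single
  replacement suffices.\<close>

lemma list_function_map:
  assumes step: "\<And>ws i. length ws = n \<Longrightarrow> i < n \<Longrightarrow> f (ws[i := \<pi> (ws ! i)]) = f ws"
    and "length vs = n"
  shows "f (map \<pi> vs) = f vs"
proof -
  have "j \<le> n \<Longrightarrow> f (map \<pi> (take j vs) @ drop j vs) = f vs" for j
  proof (induction j)
    case (Suc j)
    let ?ws = "map \<pi> (take j vs) @ drop j vs"
    have "map \<pi> (take (Suc j) vs) @ drop (Suc j) vs = ?ws[j := \<pi> (?ws ! j)]"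
      using Suc.prems \<open>length vs = n\<close>
      by (simp add: take_Suc_conv_app_nth list_update_append nth_append flip: Cons_nth_drop_Suc)
    then show ?case using Suc step[of ?ws j] \<open>length vs = n\<close> by simp
  qed simp
  from this[of n] show ?thesis using \<open>length vs = n\<close> by simp
qed

section \<open>Multiplication of tangent vectors\<close>

locale lie_groupoid_loc =
  fixes G :: "('g::{t2_space, second_countable_topology}, 'a::real_inner,
               'm::{t2_space, second_countable_topology}, 'b::real_inner) groupoid_data"
  assumes lie_groupoid: "lie_groupoid G"
begin

abbreviation "\<A> \<equiv> arrows G"
abbreviation "\<M> \<equiv> objects G"
abbreviation "\<s> \<equiv> src G"
abbreviation "\<t> \<equiv> tgt G"
abbreviation "\<e> \<equiv> unit_at G"
abbreviation "\<ii> \<equiv> inverse_of G"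
abbreviation "ds \<equiv> mdiff \<A> \<M> \<s>"
abbreviation "dt \<equiv> mdiff \<A> \<M> \<t>"
abbreviation "de \<equiv> mdiff \<M> \<A> \<e>"
abbreviation "di \<equiv> mdiff \<A> \<A> \<ii>"
abbreviation "\<P> \<equiv> prod_atlas \<A> \<A>"
abbreviation "mulp \<equiv> \<lambda>(g, h). mult G g h"

section \<open>Groupoid laws and the differentials of the structure maps\<close>

lemma manifolds: "smooth_manifold \<A>" "smooth_manifold \<M>"
  using lie_groupoid by (simp_all add: lie_groupoid_def)

lemma diff_atlas: "diff_atlas \<A>" "diff_atlas \<M>" "diff_atlas \<P>"
  using manifolds by (simp_all add: smooth_manifold_diff_atlas diff_atlas_prod)

lemma groupoid:
  "\<s> (\<e> x) = x" "\<t> (\<e> x) = x" "\<s> (\<ii> g) = \<t> g" "\<t> (\<ii> g) = \<s> g"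
  "mult G (\<e> (\<t> g)) g = g" "mult G g (\<e> (\<s> g)) = g"
  "mult G g (\<ii> g) = \<e> (\<t> g)" "mult G (\<ii> g) g = \<e> (\<s> g)"
  using lie_groupoid by (simp_all add: lie_groupoid_def)

lemma src_tgt_mult:
  "\<s> g = \<t> h \<Longrightarrow> \<s> (mult G g h) = \<s> h" "\<s> g = \<t> h \<Longrightarrow> \<t> (mult G g h) = \<t> g"
  using lie_groupoid by (simp_all add: lie_groupoid_def)

lemma mult_assoc:
  "\<s> g = \<t> h \<Longrightarrow> \<s> h = \<t> l \<Longrightarrow> mult G (mult G g h) l = mult G g (mult G h l)"
  using lie_groupoid by (simp add: lie_groupoid_def)

lemma mult_unit: "mult G (\<e> x) (\<e> x) = \<e> x"
  using groupoid(5)[of "\<e> x"] by (simp add: groupoid)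

lemma inverse_inverse: "\<ii> (\<ii> g) = g"
proof -
  have "\<ii> (\<ii> g) = mult G (\<ii> (\<ii> g)) (mult G (\<ii> g) g)"
    using groupoid(6)[of "\<ii> (\<ii> g)"] by (simp add: groupoid)
  also have "\<dots> = mult G (mult G (\<ii> (\<ii> g)) (\<ii> g)) g"
    by (rule mult_assoc[symmetric]) (simp_all add: groupoid)
  also have "\<dots> = g" by (simp add: groupoid)
  finally show ?thesis .
qed

lemma mdifferentiable_structure:
  "mdifferentiable \<A> \<M> \<s> g" "mdifferentiable \<A> \<M> \<t> g" "mdifferentiable \<M> \<A> \<e> x"
  "mdifferentiable \<A> \<A> \<ii> g"
  using lie_groupoid unfolding lie_groupoid_def
  by (auto intro!: smooth_map_on_mdifferentiable[where W = UNIV] diff_atlas)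

lemmas linear_structure = mdifferentiable_structure[THEN linear_mdiff]

lemma surj_ds: "surj (ds g)" and surj_dt: "surj (dt g)"
  using lie_groupoid by (simp_all add: lie_groupoid_def)

lemma mdiff_src_unit: "ds (\<e> x) (de x X) = X" and mdiff_tgt_unit: "dt (\<e> x) (de x X) = X"
  using mdiff_compose(2)[OF diff_atlas(2,1) mdifferentiable_structure(3) mdifferentiable_structure(1), of x X]
    mdiff_compose(2)[OF diff_atlas(2,1) mdifferentiable_structure(3) mdifferentiable_structure(2), of x X]
  by (simp_all add: groupoid mdiff_ident[OF diff_atlas(2)])

lemma mdiff_tgt_inverse: "dt (\<ii> g) (di g X) = ds g X"
  using mdiff_compose(2)[OF diff_atlas(1,1) mdifferentiable_structure(4,2), of g X]
  by (simp add: groupoid)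

lemma mdiff_inverse_inverse: "di g (di (\<ii> g) X) = X"
  using mdiff_compose(2)[OF diff_atlas(1,1) mdifferentiable_structure(4,4), of "\<ii> g" X]
  by (simp add: inverse_inverse mdiff_ident[OF diff_atlas(1)])

text \<open>The graph of the multiplication of the tangent groupoid.\<close>

definition tangent_mult :: "'g \<Rightarrow> 'g \<Rightarrow> 'a \<Rightarrow> 'a \<Rightarrow> 'a \<Rightarrow> bool" where
  "tangent_mult g h X Y V \<longleftrightarrow>
     (\<exists>Z\<in>composable_tangent G (g, h). mdiff \<P> \<A> fst (g, h) Z = X \<and> mdiff \<P> \<A> snd (g, h) Z = Y \<and>
        mdiff_within \<P> \<A> (composable G) mulp (g, h) Z = V)"

text \<open>The very extension that \<open>mdiff_within\<close> selects. Naming it turns the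
  differential of the multiplication into an ordinary \<open>mdiff\<close>, to which the chain rule
  applies.\<close>

definition mult_ext :: "'g \<Rightarrow> 'g \<Rightarrow> 'g \<times> 'g \<Rightarrow> 'g" where
  "mult_ext g h = (SOME f'. local_extension \<P> \<A> (composable G) mulp (g, h) f')"

lemma mult_ext:
  assumes "\<s> g = \<t> h"
  shows "mdifferentiable \<P> \<A> (mult_ext g h) (g, h)"
    and "\<forall>\<^sub>F q in nhds (g, h). q \<in> composable G \<longrightarrow> mult_ext g h q = mulp q"
proof -
  have "smooth_map_within \<P> \<A> (composable G) mulp"
    using lie_groupoid by (simp add: lie_groupoid_def)
  then have "\<exists>f'. local_extension \<P> \<A> (composable G) mulp (g, h) f'"
    using assms by (simp add: smooth_map_within_def composable_def)
  then have "local_extension \<P> \<A> (composable G) mulp (g, h) (mult_ext g h)"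
    unfolding mult_ext_def by (rule someI_ex)
  then obtain W where W: "(g, h) \<in> W" "smooth_map_on \<P> \<A> W (mult_ext g h)"
      "\<forall>q\<in>composable G \<inter> W. mult_ext g h q = mulp q"
    unfolding local_extension_def by blast
  show "mdifferentiable \<P> \<A> (mult_ext g h) (g, h)"
    using W by (intro smooth_map_on_mdifferentiable[of _ _ W] diff_atlas)
  have "open W" using W(2) by (simp add: smooth_map_on_def)
  then have "\<forall>\<^sub>F q in nhds (g, h). q \<in> W" using W(1) by (rule eventually_nhds_in_open)
  then show "\<forall>\<^sub>F q in nhds (g, h). q \<in> composable G \<longrightarrow> mult_ext g h q = mulp q"
    by eventually_elim (use W(3) in blast)
qed

lemma mdiff_within_mult:
  "mdiff_within \<P> \<A> (composable G) mulp (g, h) = mdiff \<P> \<A> (mult_ext g h) (g, h)"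
  by (simp add: mdiff_within_def mult_ext_def)

text \<open>Along a pair of maps that stays composable, the extension agrees with the multiplication
  near \<open>x\<close>, so the chain rule for the extension gives the derivative of the
  product.\<close>

lemma mdiff_mult:
  fixes N :: "('n::t2_space, 'e::real_normed_vector) atlas"
  assumes N: "diff_atlas N" and f: "mdifferentiable N \<A> f x" and f': "mdifferentiable N \<A> f' x"
    and c: "\<s> (f x) = \<t> (f' x)" and ev: "\<forall>\<^sub>F y in nhds x. \<s> (f y) = \<t> (f' y)"
  shows "mdifferentiable N \<A> (\<lambda>y. mult G (f y) (f' y)) x"
    and "mdiff N \<A> (\<lambda>y. mult G (f y) (f' y)) x v =
      mdiff_within \<P> \<A> (composable G) mulp (f x, f' x) (mdiff N \<P> (\<lambda>y. (f y, f' y)) x v)"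
proof -
  let ?p = "\<lambda>y. (f y, f' y)" and ?m = "mult_ext (f x) (f' x)"
  note p = mdifferentiable_Pair[OF N diff_atlas(1,1) f f']
  have "filterlim ?p (nhds (?p x)) (nhds x)"
    using p isCont_tendsto_nhds unfolding mdifferentiable_def by blast
  then have "\<forall>\<^sub>F y in nhds x. ?p y \<in> composable G \<longrightarrow> ?m (?p y) = mulp (?p y)"
    using mult_ext(2)[OF c] unfolding filterlim_iff by blast
  with ev have "\<forall>\<^sub>F y in nhds x. ?m (?p y) = mult G (f y) (f' y)"
    by eventually_elim (simp add: composable_def)
  note * = mdiff_cong[OF N mdifferentiable_compose[OF N diff_atlas(3) p mult_ext(1)[OF c]] this]
  show "mdifferentiable N \<A> (\<lambda>y. mult G (f y) (f' y)) x" by (rule *)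
  show "mdiff N \<A> (\<lambda>y. mult G (f y) (f' y)) x v =
      mdiff_within \<P> \<A> (composable G) mulp (f x, f' x) (mdiff N \<P> (\<lambda>y. (f y, f' y)) x v)"
    unfolding *(2) mdiff_within_mult by (rule mdiff_compose(2)[OF N diff_atlas(3) p mult_ext(1)[OF c]])
qed

text \<open>Differentiating the identity between \<open>\<s> (f y)\<close> and
  \<open>\<t> (f' y)\<close> shows that the pair of velocities is tangent to the composable arrows;
  \<open>mdiff_mult\<close> identifies their product.\<close>

lemma tangent_multI:
  fixes N :: "('n::t2_space, 'e::real_normed_vector) atlas"
  assumes N: "diff_atlas N" and f: "mdifferentiable N \<A> f x" and f': "mdifferentiable N \<A> f' x"
    and ev: "\<forall>\<^sub>F y in nhds x. \<s> (f y) = \<t> (f' y)"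
  shows "tangent_mult (f x) (f' x) (mdiff N \<A> f x v) (mdiff N \<A> f' x v)
    (mdiff N \<A> (\<lambda>y. mult G (f y) (f' y)) x v)"
proof -
  have c: "\<s> (f x) = \<t> (f' x)" using eventually_nhds_x_imp_x[OF ev] .
  let ?Z = "mdiff N \<P> (\<lambda>y. (f y, f' y)) x v"
  have "mdiff N \<M> (\<lambda>y. \<t> (f' y)) x = mdiff N \<M> (\<lambda>y. \<s> (f y)) x"
    by (rule mdiff_cong(2)[OF N mdifferentiable_compose[OF N diff_atlas(1) f mdifferentiable_structure(1)] ev])
  then have "ds (f x) (mdiff N \<A> f x v) = dt (f' x) (mdiff N \<A> f' x v)"
    using mdiff_compose(2)[OF N diff_atlas(1) f mdifferentiable_structure(1), of v]
      mdiff_compose(2)[OF N diff_atlas(1) f' mdifferentiable_structure(2), of v] by simp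
  then have "?Z \<in> composable_tangent G (f x, f' x)"
    by (simp add: composable_tangent_def mdiff_Pair[OF N diff_atlas(1,1) f f'])
  then show ?thesis
    unfolding tangent_mult_def
    by (rule bexI[rotated]) (simp add: mdiff_Pair[OF N diff_atlas(1,1) f f'] mdiff_mult(2)[OF N f f' c ev])
qed

text \<open>This and the next three lemmas differentiate a groupoid law with respect to the arrow or
  the object: the two unit laws, the inverse law, and the idempotence of units.\<close>

lemma tangent_mult_unit_left: "tangent_mult (\<e> (\<t> g)) g (de (\<t> g) (dt g Y)) Y Y"
  using tangent_multI[OF diff_atlas(1) mdifferentiable_compose[OF diff_atlas(1,2)
      mdifferentiable_structure(2,3)] mdiff_ident(1)[OF diff_atlas(1)], of g Y]
    mdiff_compose(2)[OF diff_atlas(1,2) mdifferentiable_structure(2,3), of g Y]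
  by (simp add: groupoid mdiff_ident[OF diff_atlas(1)])

lemma tangent_mult_unit_right: "tangent_mult g (\<e> (\<s> g)) Y (de (\<s> g) (ds g Y)) Y"
  using tangent_multI[OF diff_atlas(1) mdiff_ident(1)[OF diff_atlas(1)]
      mdifferentiable_compose[OF diff_atlas(1,2) mdifferentiable_structure(1,3)], of g Y]
    mdiff_compose(2)[OF diff_atlas(1,2) mdifferentiable_structure(1,3), of g Y]
  by (simp add: groupoid mdiff_ident[OF diff_atlas(1)])

lemma tangent_mult_inverse: "tangent_mult g (\<ii> g) Y (di g Y) (de (\<t> g) (dt g Y))"
  using tangent_multI[OF diff_atlas(1) mdiff_ident(1)[OF diff_atlas(1)] mdifferentiable_structure(4), of g Y]
    mdiff_compose(2)[OF diff_atlas(1,2) mdifferentiable_structure(2,3), of g Y]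
  by (simp add: groupoid mdiff_ident[OF diff_atlas(1)])

lemma tangent_mult_unit_unit: "tangent_mult (\<e> x) (\<e> x) (de x X) (de x X) (de x X)"
  using tangent_multI[OF diff_atlas(2) mdifferentiable_structure(3,3), of x X]
  by (simp add: groupoid mult_unit)

text \<open>The map sending \<open>h\<close> to \<open>(h, g)\<close> may leave the composable
  pairs, yet it sends \<open>u\<close> to a vector tangent to them because \<open>u\<close> is
  killed by \<open>ds\<close>. So no curve in a source fibre is needed here.\<close>

lemma tangent_mult_right_translation:
  assumes u: "u \<in> algebroid_fibre G (\<t> g)"
  shows "\<exists>Y. tangent_mult (\<e> (\<t> g)) g u 0 Y"
proof -
  let ?Z = "mdiff \<A> \<P> (\<lambda>h. (h, g)) (\<e> (\<t> g)) u"
  note Pair = mdiff_Pair[OF diff_atlas(1,1,1) mdiff_ident(1)[OF diff_atlas(1)] mdiff_const(1), of "\<e> (\<t> g)" g u]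
  have "?Z \<in> composable_tangent G (\<e> (\<t> g), g)"
    using u by (simp add: composable_tangent_def Pair mdiff_ident[OF diff_atlas(1)] mdiff_const
      algebroid_fibre_def linear_0[OF linear_structure(2)])
  then show ?thesis
    unfolding tangent_mult_def
    using Pair by (auto simp: mdiff_ident[OF diff_atlas(1)] mdiff_const)
qed

text \<open>The vector \<open>X\<close> is the velocity of a curve in the source fibre of \<open>g\<close>, and \<open>u\<close> that of its
  right translate by the inverse of \<open>g\<close>. Translating back by \<open>g\<close> recovers \<open>X\<close> from \<open>u\<close>.\<close>

lemma tangent_mult_source_fibre:
  assumes X: "ds g X = 0"
  shows "\<exists>u\<in>algebroid_fibre G (\<t> g). tangent_mult g (\<ii> g) X 0 u \<and> (u = 0 \<longrightarrow> X = 0)"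
proof -
  note R = diff_atlas_real
  obtain c where c: "c 0 = g" "mdifferentiable real_atlas \<A> c 0" "mdiff real_atlas \<A> c 0 1 = X"
    "\<forall>\<^sub>F \<tau> in nhds 0. \<s> (c \<tau>) = \<s> g"
    using submersion_fibre_curve[OF manifolds _ surj_ds X] lie_groupoid
    unfolding lie_groupoid_def by blast
  define e where "e \<tau> = mult G (c \<tau>) (\<ii> g)" for \<tau>
  define u where "u = mdiff real_atlas \<A> e 0 1"
  have e0: "e 0 = \<e> (\<t> g)" by (simp add: e_def c groupoid)
  have comp: "\<forall>\<^sub>F \<tau> in nhds 0. \<s> (c \<tau>) = \<t> (\<ii> g)" using c(4) by (simp add: groupoid)
  have T: "tangent_mult g (\<ii> g) X 0 u"
    using tangent_multI[OF R c(2) mdiff_const(1) comp, of 1]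
    by (simp add: c u_def e_def[abs_def] mdiff_const)
  have e: "mdifferentiable real_atlas \<A> e 0"
    unfolding e_def[abs_def]
    by (rule mdiff_mult(1)[OF R c(2) mdiff_const(1) _ comp]) (simp add: c groupoid)
  have src_e: "\<forall>\<^sub>F \<tau> in nhds 0. \<s> (e \<tau>) = \<t> g"
    using comp by eventually_elim (simp add: e_def src_tgt_mult groupoid)
  \<comment> \<open>The translated curve stays in the source fibre over \<open>\<t> g\<close>, so
    its velocity lies in the algebroid.\<close>
  have "mdiff real_atlas \<M> (\<lambda>\<tau>. \<s> (e \<tau>)) 0 1 = 0"
    using mdiff_cong(2)[OF R mdiff_const(1)[of real_atlas \<M> "\<t> g" 0] src_e[THEN eventually_mono, OF sym]]
    by (simp add: mdiff_const)
  then have uA: "u \<in> algebroid_fibre G (\<t> g)"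
    using mdiff_compose(2)[OF R diff_atlas(1) e mdifferentiable_structure(1), of 1]
    by (simp add: algebroid_fibre_def u_def e0)
  have translate_back: "\<forall>\<^sub>F \<tau> in nhds 0. mult G (e \<tau>) g = c \<tau>"
    using comp c(4)
  proof eventually_elim
    case (elim \<tau>)
    then have "mult G (e \<tau>) g = mult G (c \<tau>) (\<e> (\<s> (c \<tau>)))"
      unfolding e_def by (subst mult_assoc) (simp_all add: groupoid)
    then show ?case by (simp add: groupoid)
  qed
  have "X = 0" if "u = 0"
  proof -
    have "mdiff real_atlas \<A> c 0 1 = mdiff real_atlas \<A> (\<lambda>\<tau>. mult G (e \<tau>) g) 0 1"
      by (rule fun_cong[OF mdiff_cong(2)], rule R, rule mdiff_mult(1)[OF R e mdiff_const(1) _ src_e])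
        (simp_all add: e0 groupoid translate_back)
    also have "\<dots> = mdiff_within \<P> \<A> (composable G) mulp (e 0, g) (mdiff real_atlas \<P> (\<lambda>\<tau>. (e \<tau>, g)) 0 1)"
      by (rule mdiff_mult(2)[OF R e mdiff_const(1) _ src_e]) (simp add: e0 groupoid)
    \<comment> \<open>Factoring the curve of pairs through \<open>e\<close> makes its velocity a
      linear image of \<open>u\<close>, which vanishes with \<open>u\<close>.\<close>
    also have "mdiff real_atlas \<P> (\<lambda>\<tau>. (e \<tau>, g)) 0 1 = mdiff \<A> \<P> (\<lambda>h. (h, g)) (e 0) u"
      unfolding u_def
      by (rule mdiff_compose(2)[OF R diff_atlas(1) e mdifferentiable_Pair[OF diff_atlas(1,1,1)
            mdiff_ident(1)[OF diff_atlas(1)] mdiff_const(1)]])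
    also have "\<dots> = 0"
      unfolding that by (intro linear_0 linear_mdiff mdifferentiable_Pair mdiff_ident mdiff_const diff_atlas)
    also have "mdiff_within \<P> \<A> (composable G) mulp (e 0, g) 0 = 0"
      unfolding mdiff_within_mult
      by (intro linear_0 linear_mdiff mult_ext(1)) (simp add: e0 groupoid)
    finally show "X = 0" using c(3) by simp
  qed
  then show ?thesis using T uA by blast
qed

end

section \<open>Multiplicative forms\<close>

locale multiplicative_form = lie_groupoid_loc G
  for G :: "('g::{t2_space, second_countable_topology}, 'a::real_inner,
             'm::{t2_space, second_countable_topology}, 'b::real_inner) groupoid_data" +
  fixes k :: nat and \<omega> :: "('g, 'a) form" and \<mu> :: "'m \<Rightarrow> 'a \<Rightarrow> 'b list \<Rightarrow> real"
  assumes alternating: "alternating_form (Suc k) (\<omega> g)"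
    and multiplicative: "multiplicative G (Suc k) \<omega>"
    and corresponds: "corresponds G k \<omega> \<mu>"
begin

text \<open>Each entry of \<open>Ts\<close> is a triple of two tangent vectors and a product of
  them, so that all arguments of the form are multiplied at once.\<close>

lemma form_mult:
  assumes "\<s> g = \<t> h" "length Ts = Suc k"
    and "\<forall>T\<in>set Ts. tangent_mult g h (fst T) (fst (snd T)) (snd (snd T))"
  shows "\<omega> (mult G g h) (map (\<lambda>T. snd (snd T)) Ts) =
    \<omega> g (map fst Ts) + \<omega> h (map (\<lambda>T. fst (snd T)) Ts)"
proof -
  obtain z where z: "\<forall>T\<in>set Ts. z T \<in> composable_tangent G (g, h) \<and>
      mdiff \<P> \<A> fst (g, h) (z T) = fst T \<and> mdiff \<P> \<A> snd (g, h) (z T) = fst (snd T) \<and>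
      mdiff_within \<P> \<A> (composable G) mulp (g, h) (z T) = snd (snd T)"
    using assms(3) unfolding tangent_mult_def by metis
  have "(g, h) \<in> composable G" "length (map z Ts) = Suc k" "set (map z Ts) \<subseteq> composable_tangent G (g, h)"
    using assms(1,2) z by (auto simp: composable_def)
  then have "\<omega> (mulp (g, h)) (map (mdiff_within \<P> \<A> (composable G) mulp (g, h)) (map z Ts)) =
      \<omega> (fst (g, h)) (map (mdiff \<P> \<A> fst (g, h)) (map z Ts)) +
      \<omega> (snd (g, h)) (map (mdiff \<P> \<A> snd (g, h)) (map z Ts))"
    using multiplicative unfolding multiplicative_def Let_def by blast
  moreover have "map (mdiff_within \<P> \<A> (composable G) mulp (g, h)) (map z Ts) = map (\<lambda>T. snd (snd T)) Ts"
    "map (mdiff \<P> \<A> fst (g, h)) (map z Ts) = map fst Ts"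
    "map (mdiff \<P> \<A> snd (g, h)) (map z Ts) = map (\<lambda>T. fst (snd T)) Ts"
    using z by auto
  ultimately show ?thesis by (simp del: map_map)
qed

text \<open>Unit vectors are idempotent, so the value equals twice itself.\<close>

lemma form_units:
  assumes "length Xs = Suc k"
  shows "\<omega> (\<e> x) (map (de x) Xs) = 0"
  using form_mult[of "\<e> x" "\<e> x" "map (\<lambda>X. (de x X, de x X, de x X)) Xs"] assms
  by (auto simp: tangent_mult_unit_unit groupoid mult_unit o_def)

text \<open>The product of a vector with its inverse is a unit vector, and the form vanishes on unit
  vectors.\<close>

lemma form_inverse:
  assumes "length Ys = Suc k"
  shows "\<omega> (\<ii> g) (map (di g) Ys) = - \<omega> g Ys"
  using form_mult[of g "\<ii> g" "map (\<lambda>Y. (Y, di g Y, de (\<t> g) (dt g Y))) Ys"] assms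
    form_units[of "map (dt g) Ys" "\<t> g"]
  by (auto simp: tangent_mult_inverse groupoid o_def)

text \<open>Each \<open>Ys\<close> entry is a unit vector times itself, while \<open>Y\<close> is
  \<open>u\<close> times 0. Multiplicativity leaves the value at the unit arrow, since the term at
  \<open>g\<close> contains a zero vector.\<close>

lemma form_right_translation:
  assumes u: "u \<in> algebroid_fibre G (\<t> g)" and T: "tangent_mult (\<e> (\<t> g)) g u 0 Y" and Ys: "length Ys = k"
  shows "\<omega> g (Y # Ys) = \<mu> (\<t> g) u (map (dt g) Ys)"
  using form_mult[of "\<e> (\<t> g)" g "(u, 0, Y) # map (\<lambda>Y. (de (\<t> g) (dt g Y), Y, Y)) Ys"] T Ys
    alternating_form_zero[OF alternating Ys] corresponds u
  by (auto simp: tangent_mult_unit_left groupoid o_def corresponds_def)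

lemma form_algebroid:
  assumes u: "u \<in> algebroid_fibre G x" and Ys: "length Ys = k"
  shows "\<omega> (\<e> x) (u # Ys) = \<mu> x u (map (dt (\<e> x)) Ys)"
proof -
  \<comment> \<open>Right translation by a unit is trivial: the unit vector belonging to the source
    of \<open>u\<close> is 0.\<close>
  have "tangent_mult (\<e> x) (\<e> x) u 0 u"
    using tangent_mult_unit_right[of "\<e> x" u] u
    by (simp add: groupoid algebroid_fibre_def linear_0[OF linear_structure(3)])
  then show ?thesis
    using form_right_translation[of u "\<e> x" u Ys] u Ys by (simp add: groupoid)
qed

section \<open>Nondegeneracy implies both conditions on the IM form\<close>

lemma nondegenerate_imp_kernel:
  assumes "nondegenerate (Suc k) \<omega>"
  shows "IM_kernel G k \<mu> x = {0}"
proof -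
  have 0: "0 \<in> algebroid_fibre G x"
    by (simp add: algebroid_fibre_def linear_0[OF linear_structure(1)])
  then have "0 \<in> IM_kernel G k \<mu> x"
    using corresponds alternating_form_zero[OF alternating] by (simp add: IM_kernel_def corresponds_def)
  moreover have "u = 0" if "u \<in> IM_kernel G k \<mu> x" for u
  proof -
    \<comment> \<open>By \<open>form_algebroid\<close> vanishing on vectors tangent to the units
      extends to all tangent vectors at the unit.\<close>
    have "\<omega> (\<e> x) (u # Ys) = 0" if "length Ys = k" for Ys
      using \<open>u \<in> _\<close> that by (simp add: IM_kernel_def form_algebroid)
    then show ?thesis using assms unfolding nondegenerate_def by blast
  qed
  ultimately show ?thesis by blast
qed

text \<open>The unit vector of \<open>X\<close> lies in the kernel of the form:
  \<open>?\<pi>\<close> projects the other arguments to unit vectors, where isotropy applies, and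
  the parts removed lie in the algebroid, where the annihilator condition applies.\<close>

lemma nondegenerate_imp_annihilator:
  assumes nd: "nondegenerate (Suc k) \<omega>"
  shows "IM_image_annihilator G k \<mu> x = {0}"
proof -
  have "0 \<in> IM_image_annihilator G k \<mu> x"
  proof -
    have "\<omega> (\<e> x) (u # 0 # Ys) = 0" if "Suc (length Ys) = k" for u Ys
      using linear_0[OF alternating_form_linear[OF alternating, of "u # 0 # Ys" 1]] that by auto
    then show ?thesis
      using corresponds
      by (auto simp: IM_image_annihilator_def corresponds_def linear_0[OF linear_structure(3)])
  qed
  moreover have "X = 0" if X: "X \<in> IM_image_annihilator G k \<mu> x" for X
  proof -
    let ?X = "de x X" and ?\<pi> = "\<lambda>Y. de x (ds (\<e> x) Y)"
    have A: "\<omega> (\<e> x) (u # ?X # Ys) = 0" if "u \<in> algebroid_fibre G x" "Suc (Suc (length Ys)) = Suc k" for u Ys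
      using that X form_algebroid[of u x "?X # Ys"] by (auto simp: IM_image_annihilator_def mdiff_tgt_unit)
    have fib: "Y - ?\<pi> Y \<in> algebroid_fibre G x" for Y
      by (simp add: algebroid_fibre_def linear_diff[OF linear_structure(1)] mdiff_src_unit)
    have "\<omega> (\<e> x) (?X # Ys[i := ?\<pi> (Ys ! i)]) = \<omega> (\<e> x) (?X # Ys)" if Ys: "length Ys = k" "i < k" for Ys i
    proof -
      \<comment> \<open>The algebroid vector at position \<open>Suc i\<close> and \<open>?X\<close>
        at position 0 are moved to the front, in the order in which \<open>A\<close>
        applies.\<close>
      have "\<omega> (\<e> x) (?X # Ys[i := Ys ! i - ?\<pi> (Ys ! i)]) = 0"
        by (rule alternating_form_eq_0[OF alternating, of _ "Suc i" 0])
          (use Ys A[OF fib] in auto)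
      then show ?thesis
        using linear_diff[OF alternating_form_linear[OF alternating, of "?X # Ys" "Suc i" "\<e> x"], of "Ys ! i" "?\<pi> (Ys ! i)"] Ys
        by simp
    qed
    then have "\<omega> (\<e> x) (?X # map ?\<pi> Ys) = \<omega> (\<e> x) (?X # Ys)" if "length Ys = k" for Ys
      using list_function_map[of k "\<lambda>Ys. \<omega> (\<e> x) (?X # Ys)" ?\<pi> Ys] that by simp
    moreover have "\<omega> (\<e> x) (?X # map ?\<pi> Ys) = 0" if "length Ys = k" for Ys
      using form_units[of "X # map (ds (\<e> x)) Ys" x] that by (simp add: o_def)
    ultimately have "\<forall>Ys. Suc (length Ys) = Suc k \<longrightarrow> \<omega> (\<e> x) (?X # Ys) = 0" by simp
    with nd have "?X = 0" unfolding nondegenerate_def by blast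
    then show "X = 0" using mdiff_src_unit[of x X] linear_0[OF linear_structure(1)] by simp
  qed
  ultimately show ?thesis by blast
qed

section \<open>Both conditions imply nondegeneracy\<close>

lemma kernel_form_imp_mdiff_tgt_eq_0:
  assumes X: "\<And>Ys. length Ys = k \<Longrightarrow> \<omega> g (X # Ys) = 0"
    and ann: "IM_image_annihilator G k \<mu> (\<t> g) = {0}"
  shows "dt g X = 0"
proof -
  have "dt g X \<in> IM_image_annihilator G k \<mu> (\<t> g)"
    unfolding IM_image_annihilator_def
  proof (intro CollectI ballI allI impI)
    fix u and Xs :: "'b list" assume u: "u \<in> algebroid_fibre G (\<t> g)" and Xs: "Suc (length Xs) = k"
    obtain Y where Y: "tangent_mult (\<e> (\<t> g)) g u 0 Y"
      using tangent_mult_right_translation[OF u] by blast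
    \<comment> \<open>Surjectivity of \<open>dt\<close> lifts arbitrary vectors on the base to
      \<open>g\<close>, where the translation formula can be used.\<close>
    obtain Ys where Ys: "Xs = map (dt g) Ys"
      using surj_dt[of g] by (metis ex_map_conv surjD)
    \<comment> \<open>Exchanging the first two arguments puts the kernel vector \<open>X\<close> in
      front.\<close>
    have "\<omega> g (Y # X # Ys) = 0"
      by (rule alternating_form_eq_0[OF alternating, of _ 1 0]) (use Xs Ys X in auto)
    then show "\<mu> (\<t> g) u (dt g X # Xs) = 0"
      using form_right_translation[OF u Y, of "X # Ys"] Xs Ys by simp
  qed
  then show ?thesis using ann by simp
qed

lemma nondegenerateI:
  assumes ker: "\<And>x. IM_kernel G k \<mu> x = {0}" and ann: "\<And>x. IM_image_annihilator G k \<mu> x = {0}"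
  shows "nondegenerate (Suc k) \<omega>"
  unfolding nondegenerate_def
proof safe
  fix g X assume "\<forall>vs. Suc (length vs) = Suc k \<longrightarrow> \<omega> g (X # vs) = 0"
  then have X: "\<omega> g (X # Ys) = 0" if "length Ys = k" for Ys using that by simp
  \<comment> \<open>Inversion carries kernel vectors to kernel vectors and exchanges source and
    target, so the result for \<open>dt\<close> at \<open>\<ii> g\<close> becomes one for
    \<open>ds\<close> at \<open>g\<close>.\<close>
  have "\<omega> (\<ii> g) (di g X # Ws) = 0" if Ws: "length Ws = k" for Ws
  proof -
    have "map (di g) (map (di (\<ii> g)) Ws) = Ws"
      by (simp add: o_def mdiff_inverse_inverse)
    then show ?thesis
      using form_inverse[of "X # map (di (\<ii> g)) Ws" g] X[of "map (di (\<ii> g)) Ws"] Ws by simp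
  qed
  from kernel_form_imp_mdiff_tgt_eq_0[OF this ann] have "ds g X = 0"
    by (simp add: mdiff_tgt_inverse)
  then obtain u where u: "u \<in> algebroid_fibre G (\<t> g)" "tangent_mult g (\<ii> g) X 0 u" "u = 0 \<longrightarrow> X = 0"
    using tangent_mult_source_fibre by blast
  have "\<mu> (\<t> g) u Xs = 0" if Xs: "length Xs = k" for Xs
  proof -
    obtain Ys where Ys: "Xs = map (dt g) Ys"
      using surj_dt[of g] by (metis ex_map_conv surjD)
    \<comment> \<open>Here \<open>u\<close> is the product of \<open>X\<close> and 0, and the other
      arguments are products of vectors with their inverses. One summand then contains the kernel
      vector \<open>X\<close>, the other a zero vector.\<close>
    have "\<omega> (\<e> (\<t> g)) (u # map (de (\<t> g)) Xs) = \<omega> g (X # Ys) + \<omega> (\<ii> g) (0 # map (di g) Ys)"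
      using form_mult[of g "\<ii> g" "(X, 0, u) # map (\<lambda>Y. (Y, di g Y, de (\<t> g) (dt g Y))) Ys"] u Xs Ys
      by (auto simp: tangent_mult_inverse groupoid o_def)
    also have "\<dots> = 0"
      using X alternating_form_zero[OF alternating, of "map (di g) Ys"] Xs Ys by simp
    finally show ?thesis using corresponds u(1) Xs by (simp add: corresponds_def)
  qed
  then have "u \<in> IM_kernel G k \<mu> (\<t> g)" using u(1) by (simp add: IM_kernel_def)
  then show "X = 0" using ker u(3) by simp
qed

end

theorem proposition4p1:
  fixes G :: "('g::{t2_space, second_countable_topology}, 'a::real_inner,
               'm::{t2_space, second_countable_topology}, 'b::real_inner) groupoid_data"
    and k :: nat
    and \<omega> :: "('g, 'a) form"
    and \<mu> :: "'m \<Rightarrow> 'a \<Rightarrow> 'b list \<Rightarrow> real"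
  assumes "k \<ge> 1"
    and "lie_groupoid G"
    and "source_simply_connected G"
    and "smooth_form (arrows G) (k + 1) \<omega>"
    and "closed_form (arrows G) (k + 1) \<omega>"
    and "multiplicative G (k + 1) \<omega>"
    and "closed_IM_form G k \<mu>"
    and "corresponds G k \<omega> \<mu>"
  shows "nondegenerate (k + 1) \<omega> \<longleftrightarrow>
    (\<forall>x. IM_kernel G k \<mu> x = {0}) \<and> (\<forall>x. IM_image_annihilator G k \<mu> x = {0})"
proof -
  interpret multiplicative_form G k \<omega> \<mu>
    using assms by unfold_locales (simp_all add: smooth_form_def)
  show ?thesis
    using nondegenerateI nondegenerate_imp_kernel nondegenerate_imp_annihilator by auto
qed

end
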